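(* Let $\Omega\subset\mathbb{R}^n$ be a bounded domain and let $\{\Omega_t\}_{t\in\Gamma}$ be a countable collection of subdomains of $\Omega$ indexed by a rooted tree $\Gamma$ with root $a$, satisfying conditions (a) and (b) of the context, with overlap constant $N$ and sets $\{B_t\}_{t\ne a}$. Let $\omega$ and $T$ be the weight and operator, and let $f_t,\tilde f_t$ be the functions, defined in the context. Given $f\in L^1(\Omega)$ and $1<p<\infty$, one has $f=\sum_{t\in\Gamma}(f_t-\tilde f_t)$, and this decomposition satisfies: $\mathrm{Supp}(f_t-\tilde f_t)\subset\Omega_t$ for all $t\in\Gamma$; $\int_{\Omega_t}(f_t-\tilde f_t)=0$ for all $t\neq a$; $\int_{\Omega_a}(f_a-\tilde f_a)=\int_\Omega f$; and $$\sum_{t\in\Gamma}\|f_t-\tilde f_t\|^p_{L^p(\Omega_t,\omega)}\le C_1\|f\|^p_{L^p(\Omega)},\qquad C_1=2^pN\left(1+\frac{2^{p+1}p}{p-1}\right).$$ In addition, if $\hat\omega_1,\hat\omega_2:\Omega\to\mathbb{R}_{>0}$ are two weights such that $L^p(\Omega,\hat\omega_2)\subset L^1(\Omega)$, and the identity operator $I$ and the operator $T$ are continuous from $L^p(\Omega,\hat\omega_2)$ to $L^p(\Omega,\hat\omega_1)$ with norms $M_I$ and $M_T$ respectively, then the same decomposition also satisfies $$\sum_{t\in\Gamma}\|f_t-\tilde f_t\|^p_{L^p(\Omega_t,\omega\hat\omega_1)}\le C_2\|f\|^p_{L^p(\Omega,\hat\omega_2)},\qquad C_2=2^p\left(NM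_I^p+2M_T^p\right).$$
   Context: A weight is a measurable positive function $\omega:\Omega\to\mathbb{R}_{>0}$, and $L^p(\Omega,\omega)$ has norm $\|f\|_{L^p(\Omega,\omega)}=\|f\omega\|_{L^p(\Omega)}$ (the weight is inside the norm, not a density). Rooted tree: a connected graph in which any two vertices are joined by exactly one simple path, with a distinguished vertex $a$ (the root). Partial order: $s\preceq t$ iff the unique path connecting $t$ with $a$ passes through $s$. The parent $t_p$ of $t\ne a$ is the vertex $s\preceq t$ whose height (number of $r\preceq t$, $r\ne t$, in the case of $t$) is one less than that of $t$. Conditions on the countable collection $\{\Omega_t\}_{t\in\Gamma}$ of subdomains of $\Omega$: (a) $\chi_\Omega(x)\le\sum_{t\in\Gamma}\chi_{\Omega_t}(x)\le N\chi_\Omega(x)$ for almost every $x$, for a finite constant $N$. (b) For every $t\in\Gamma$, $t\ne a$, there is a set $B_t\subseteq\Omega_t\cap\Omega_{t_p}$ of positive Lebesgue measure, and the collection $\{B_t\}_{t\neq a}$ is pairwise disjoint. Put $W_t=\bigcup_{s\succeq t}\Omega_s$ and let $\chi_t$ be the characteristic function of $B_t$. Operator: $Tf(x):=\sum_{a\ne t\in\Gamma}\dfrac{\chi_t(x)}{|W_t|}\int_{W_t}|f|$. "Continuous with norm $M_T$" means $\|Tg\|\le M_T\|g\|$ in the indicated norms. Weight: $\omega(x):=|B_t|/|W_t|$ if $x\in B_t$ for some $t\ne a$, and $\omega(x):=1$ otherwise. Decomposition: let $\{\phi_t\}_{t\in\Gamma}$ be a partition of unity subordinated to $\{\Omega_t\}_{t\in\Gamma}$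 (measurable functions with $0\le\phi_t\le1$, $\phi_t=0$ outside $\Omega_t$, $\sum_t\phi_t=1$ a.e. in $\Omega$), put $f_t:=f\phi_t$, and define $$\tilde f_t(x):=\frac{\chi_t(x)}{|B_t|}\int_{W_t}\sum_{k\succeq t}f_k-\sum_{s:\,s_p=t}\frac{\chi_s(x)}{|B_s|}\int_{W_s}\sum_{k\succeq s}f_k ,$$ the second sum running over all $s$ whose parent is $t$; for $t=a$ the first term is omitted, i.e. $\tilde f_a(x)=-\sum_{s:\,s_p=a}\frac{\chi_s(x)}{|B_s|}\int_{W_s}\sum_{k\succeq s}f_k$. $\mathrm{Supp}(g)\subset\Omega_t$ means that $g$ vanishes outside $\Omega_t$. *)

theory Defs
  imports "HOL-Analysis.Analysis"
begin

subsection \<open>Rooted trees\<close>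

definition vertex_path :: "'v set \<Rightarrow> ('v \<Rightarrow> 'v \<Rightarrow> bool) \<Rightarrow> 'v \<Rightarrow> 'v \<Rightarrow> 'v list \<Rightarrow> bool" where
  "vertex_path V E u v xs \<longleftrightarrow>
     xs \<noteq> [] \<and> hd xs = u \<and> last xs = v \<and> set xs \<subseteq> V \<and> distinct xs \<and> successively E xs"

text \<open>Graphs are simple and undirected, possibly infinite. Connectedness is the existence part
  of the unique-path clause.\<close>

definition rooted_tree :: "'v set \<Rightarrow> ('v \<Rightarrow> 'v \<Rightarrow> bool) \<Rightarrow> 'v \<Rightarrow> bool" where
  "rooted_tree V E a \<longleftrightarrow>
     (\<forall>u v. E u v \<longrightarrow> u \<in> V \<and> v \<in> V) \<and> symp E \<and> irreflp E \<and> a \<in> V \<and>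
     (\<forall>u\<in>V. \<forall>v\<in>V. \<exists>!xs. vertex_path V E u v xs)"

definition root_path :: "'v set \<Rightarrow> ('v \<Rightarrow> 'v \<Rightarrow> bool) \<Rightarrow> 'v \<Rightarrow> 'v \<Rightarrow> 'v list" where
  "root_path V E a t = (THE xs. vertex_path V E t a xs)"

definition tree_le :: "'v set \<Rightarrow> ('v \<Rightarrow> 'v \<Rightarrow> bool) \<Rightarrow> 'v \<Rightarrow> 'v \<Rightarrow> 'v \<Rightarrow> bool" where
  "tree_le V E a s t \<longleftrightarrow> s \<in> V \<and> t \<in> V \<and> s \<in> set (root_path V E a t)"

definition height :: "'v set \<Rightarrow> ('v \<Rightarrow> 'v \<Rightarrow> bool) \<Rightarrow> 'v \<Rightarrow> 'v \<Rightarrow> nat" where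
  "height V E a t = card {r \<in> V. tree_le V E a r t \<and> r \<noteq> t}"

text \<open>Meaningful only for vertices other than the root.\<close>

definition parent :: "'v set \<Rightarrow> ('v \<Rightarrow> 'v \<Rightarrow> bool) \<Rightarrow> 'v \<Rightarrow> 'v \<Rightarrow> 'v" where
  "parent V E a t = (THE s. tree_le V E a s t \<and> height V E a t = height V E a s + 1)"

definition children :: "'v set \<Rightarrow> ('v \<Rightarrow> 'v \<Rightarrow> bool) \<Rightarrow> 'v \<Rightarrow> 'v \<Rightarrow> 'v set" where
  "children V E a t = {s \<in> V. s \<noteq> a \<and> parent V E a s = t}"

definition descendants :: "'v set \<Rightarrow> ('v \<Rightarrow> 'v \<Rightarrow> bool) \<Rightarrow> 'v \<Rightarrow> 'v \<Rightarrow> 'v set" where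
  "descendants V E a t = {k \<in> V. tree_le V E a t k}"

subsection \<open>Weighted Lebesgue spaces\<close>

text \<open>Functions on a set \<open>S\<close> are total functions of which only the values on \<open>S\<close> matter.
  Norms take values in \<open>[0, \<infinity>]\<close>; the power is used with positive exponents only.\<close>

definition ennreal_powr :: "ennreal \<Rightarrow> real \<Rightarrow> ennreal" where
  "ennreal_powr x r = (if x = \<infinity> then \<infinity> else ennreal (enn2real x powr r))"

definition Lp_norm :: "real \<Rightarrow> 'a::euclidean_space set \<Rightarrow> ('a \<Rightarrow> real) \<Rightarrow> ennreal" where
  "Lp_norm p S g = ennreal_powr (\<integral>\<^sup>+ x. ennreal (\<bar>g x\<bar> powr p) \<partial>lebesgue_on S) (1 / p)"

definition weight_on :: "'a::euclidean_space set \<Rightarrow> ('a \<Rightarrow> real) \<Rightarrow> bool" where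
  "weight_on S w \<longleftrightarrow> w \<in> borel_measurable (lebesgue_on S) \<and> (\<forall>x\<in>S. 0 < w x)"

definition wLp_norm ::
    "real \<Rightarrow> 'a::euclidean_space set \<Rightarrow> ('a \<Rightarrow> real) \<Rightarrow> ('a \<Rightarrow> real) \<Rightarrow> ennreal" where
  "wLp_norm p S w g = Lp_norm p S (\<lambda>x. g x * w x)"

definition wLp_space ::
    "real \<Rightarrow> 'a::euclidean_space set \<Rightarrow> ('a \<Rightarrow> real) \<Rightarrow> ('a \<Rightarrow> real) set" where
  "wLp_space p S w = {g \<in> borel_measurable (lebesgue_on S). wLp_norm p S w g < \<infinity>}"

text \<open>The operator \<open>A\<close> need not be linear, and \<open>M\<close> is an upper bound for its norm, not
  necessarily the least one.\<close>

definition continuous_with_norm ::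
    "real \<Rightarrow> 'a::euclidean_space set \<Rightarrow> ('a \<Rightarrow> real) \<Rightarrow> ('a \<Rightarrow> real) \<Rightarrow>
     (('a \<Rightarrow> real) \<Rightarrow> 'a \<Rightarrow> real) \<Rightarrow> real \<Rightarrow> bool" where
  "continuous_with_norm p S w w' A M \<longleftrightarrow> 0 \<le> M \<and>
     (\<forall>g\<in>wLp_space p S w.
        A g \<in> wLp_space p S w' \<and> wLp_norm p S w' (A g) \<le> ennreal M * wLp_norm p S w g)"

subsection \<open>Tree coverings\<close>

definition is_domain :: "'a::euclidean_space set \<Rightarrow> bool" where
  "is_domain S \<longleftrightarrow> open S \<and> connected S \<and> S \<noteq> {}"

text \<open>The overlap is counted in \<open>[0, \<infinity>]\<close>, so that an infinite overlap is not
  mistaken for 0.\<close>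

definition overlap_condition ::
    "'v set \<Rightarrow> ('v \<Rightarrow> 'a::euclidean_space set) \<Rightarrow> 'a set \<Rightarrow> real \<Rightarrow> bool" where
  "overlap_condition V U \<Omega> N \<longleftrightarrow>
     (AE x in lebesgue.
        (indicator \<Omega> x :: ennreal) \<le> (\<Sum>\<^sub>\<infinity>t\<in>V. indicator (U t) x) \<and>
        (\<Sum>\<^sub>\<infinity>t\<in>V. indicator (U t) x) \<le> ennreal N * indicator \<Omega> x)"

definition bridge_condition ::
    "'v set \<Rightarrow> ('v \<Rightarrow> 'v \<Rightarrow> bool) \<Rightarrow> 'v \<Rightarrow> ('v \<Rightarrow> 'a::euclidean_space set) \<Rightarrow>
     ('v \<Rightarrow> 'a set) \<Rightarrow> bool" where
  "bridge_condition V E a U B \<longleftrightarrow>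
     (\<forall>t\<in>V - {a}. B t \<subseteq> U t \<inter> U (parent V E a t) \<and>
        B t \<in> sets lebesgue \<and> 0 < emeasure lebesgue (B t)) \<and>
     disjoint_family_on B (V - {a})"

definition shadow ::
    "'v set \<Rightarrow> ('v \<Rightarrow> 'v \<Rightarrow> bool) \<Rightarrow> 'v \<Rightarrow> ('v \<Rightarrow> 'a::euclidean_space set) \<Rightarrow> 'v \<Rightarrow> 'a set" where
  "shadow V E a U t = (\<Union>s\<in>descendants V E a t. U s)"

definition tree_weight ::
    "'v set \<Rightarrow> ('v \<Rightarrow> 'v \<Rightarrow> bool) \<Rightarrow> 'v \<Rightarrow> ('v \<Rightarrow> 'a::euclidean_space set) \<Rightarrow>
     ('v \<Rightarrow> 'a set) \<Rightarrow> 'a \<Rightarrow> real" where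
  "tree_weight V E a U B x =
     (if \<exists>t\<in>V - {a}. x \<in> B t
      then let t = (THE t. t \<in> V - {a} \<and> x \<in> B t)
           in measure lebesgue (B t) / measure lebesgue (shadow V E a U t)
      else 1)"

definition tree_operator ::
    "'v set \<Rightarrow> ('v \<Rightarrow> 'v \<Rightarrow> bool) \<Rightarrow> 'v \<Rightarrow> ('v \<Rightarrow> 'a::euclidean_space set) \<Rightarrow>
     ('v \<Rightarrow> 'a set) \<Rightarrow> ('a \<Rightarrow> real) \<Rightarrow> 'a \<Rightarrow> real" where
  "tree_operator V E a U B f x =
     (\<Sum>\<^sub>\<infinity>t\<in>V - {a}. indicator (B t) x / measure lebesgue (shadow V E a U t) *
        (\<integral>y. \<bar>f y\<bar> \<partial>lebesgue_on (shadow V E a U t)))"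

subsection \<open>The decomposition\<close>

definition partition_of_unity ::
    "'v set \<Rightarrow> ('v \<Rightarrow> 'a::euclidean_space set) \<Rightarrow> 'a set \<Rightarrow> ('v \<Rightarrow> 'a \<Rightarrow> real) \<Rightarrow> bool" where
  "partition_of_unity V U \<Omega> \<phi> \<longleftrightarrow>
     (\<forall>t\<in>V. \<phi> t \<in> borel_measurable (lebesgue_on \<Omega>) \<and>
        (\<forall>x. 0 \<le> \<phi> t x \<and> \<phi> t x \<le> 1) \<and> (\<forall>x. x \<notin> U t \<longrightarrow> \<phi> t x = 0)) \<and>
     (AE x in lebesgue_on \<Omega>. ((\<lambda>t. \<phi> t x) has_sum 1) V)"

definition local_part :: "('v \<Rightarrow> 'a \<Rightarrow> real) \<Rightarrow> ('a \<Rightarrow> real) \<Rightarrow> 'v \<Rightarrow> 'a \<Rightarrow> real" where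
  "local_part \<phi> f t x = f x * \<phi> t x"

text \<open>The building block \<open>\<chi>\<^sub>t(x) / |B\<^sub>t| * \<integral>\<^bsub>W\<^sub>t\<^esub> \<Sum>\<^bsub>k\<succeq>t\<^esub> f\<^sub>k\<close> of the correction.\<close>

definition flux ::
    "'v set \<Rightarrow> ('v \<Rightarrow> 'v \<Rightarrow> bool) \<Rightarrow> 'v \<Rightarrow> ('v \<Rightarrow> 'a::euclidean_space set) \<Rightarrow>
     ('v \<Rightarrow> 'a set) \<Rightarrow> ('v \<Rightarrow> 'a \<Rightarrow> real) \<Rightarrow> ('a \<Rightarrow> real) \<Rightarrow> 'v \<Rightarrow> 'a \<Rightarrow> real" where
  "flux V E a U B \<phi> f t x =
     indicator (B t) x / measure lebesgue (B t) *
     (\<integral>y. (\<Sum>\<^sub>\<infinity>k\<in>descendants V E a t. local_part \<phi> f k y) \<partial>lebesgue_on (shadow V E a U t))"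

definition correction ::
    "'v set \<Rightarrow> ('v \<Rightarrow> 'v \<Rightarrow> bool) \<Rightarrow> 'v \<Rightarrow> ('v \<Rightarrow> 'a::euclidean_space set) \<Rightarrow>
     ('v \<Rightarrow> 'a set) \<Rightarrow> ('v \<Rightarrow> 'a \<Rightarrow> real) \<Rightarrow> ('a \<Rightarrow> real) \<Rightarrow> 'v \<Rightarrow> 'a \<Rightarrow> real" where
  "correction V E a U B \<phi> f t x =
     (if t = a then 0 else flux V E a U B \<phi> f t x) -
     (\<Sum>\<^sub>\<infinity>s\<in>children V E a t. flux V E a U B \<phi> f s x)"

definition tree_part ::
    "'v set \<Rightarrow> ('v \<Rightarrow> 'v \<Rightarrow> bool) \<Rightarrow> 'v \<Rightarrow> ('v \<Rightarrow> 'a::euclidean_space set) \<Rightarrow>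
     ('v \<Rightarrow> 'a set) \<Rightarrow> ('v \<Rightarrow> 'a \<Rightarrow> real) \<Rightarrow> ('a \<Rightarrow> real) \<Rightarrow> 'v \<Rightarrow> 'a \<Rightarrow> real" where
  "tree_part V E a U B \<phi> f t x = local_part \<phi> f t x - correction V E a U B \<phi> f t x"

end

theory Submission
  imports Defs "HOL-Library.Sublist"
begin

text \<open>Subtracting the corrections turns the pieces \<open>f\<^sub>t = f \<phi>\<^sub>t\<close> of \<open>f\<close> into pieces of mean zero by moving mass
  along the edges of the tree. The mass \<open>m\<^sub>t\<close> of all \<open>f\<^sub>k\<close> with \<open>k\<close> in the subtree at \<open>t\<close> is handed from
  \<open>t\<close> to its parent through the bridge \<open>B\<^sub>t\<close>, which lies in both subdomains. What vertex \<open>t\<close> sends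
  upwards is its own mass plus everything its children sent to it, so nothing remains except at the
  root, which collects the integral of \<open>f\<close> (lemma \<open>tail_mass_children\<close>). Each bridge occurs
  in exactly two corrections, with opposite signs, so the corrections cancel pointwise and the
  pieces still add up to \<open>f\<close> (lemma \<open>corr_has_sum_0\<close>).

  For the norm estimate, \<open>\<bar>m\<^sub>t\<bar>\<close> is at most the integral of \<open>\<bar>f\<bar>\<close> over the shadow \<open>W\<^sub>t\<close>. The
  weight \<open>|B\<^sub>t| / |W\<^sub>t|\<close> turns the height \<open>\<bar>m\<^sub>t\<bar> / |B\<^sub>t|\<close> of a correction on \<open>B\<^sub>t\<close> into at most the average
  of \<open>\<bar>f\<bar>\<close> over \<open>W\<^sub>t\<close>, which is the value of \<open>T f\<close> on \<open>B\<^sub>t\<close>. A point lies in the bridges of at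
  most two corrections, so the weighted corrections are dominated by \<open>2 (T f)\<^sup>p\<close> in total and the
  pieces \<open>f\<^sub>t\<close> by \<open>\<bar>f\<bar>\<^sup>p\<close> (lemma \<open>weighted_parts_le\<close>). In the two-weight statement the
  assumed bounds of the identity and of \<open>T\<close> then finish the proof.

  In the unweighted statement one needs that \<open>T\<close> is bounded on \<open>L\<^sup>p\<close>. This is a maximal-function
  argument in which the tree replaces the covering lemma. Among the vertices whose shadow
  average reaches a level, those closest to the root have pairwise disjoint subtrees, so
  their shadows overlap at most \<open>N\<close> times, and they contain the bridges of all the other such
  vertices. This gives the weak type bound \<open>sum_bridges_le\<close>, and truncating \<open>f\<close> at
  half the level and integrating over all levels, as in the Marcinkiewicz interpolation
  theorem, gives the strong bound \<open>sum_averages_powr_le\<close> with constant \<open>2\<^sup>p N p / (p - 1)\<close>.\<close>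

section \<open>Rooted trees\<close>

locale rooted_tree_at =
  fixes V :: "'v set" and E :: "'v \<Rightarrow> 'v \<Rightarrow> bool" and a :: 'v
  assumes tree: "rooted_tree V E a"
begin

abbreviation "rpath \<equiv> root_path V E a"
abbreviation "par \<equiv> parent V E a"
abbreviation "desc \<equiv> descendants V E a"
abbreviation "chld \<equiv> children V E a"

lemma root_in: "a \<in> V"
  using tree unfolding rooted_tree_def by blast

lemma rpath_unique: "t \<in> V \<Longrightarrow> \<exists>!xs. vertex_path V E t a xs"
  using tree root_in unfolding rooted_tree_def by blast

lemma vertex_path_rpath: "t \<in> V \<Longrightarrow> vertex_path V E t a (rpath t)"
  unfolding root_path_def by (rule theI') (rule rpath_unique)

lemma rpath_eqI: "vertex_path V E t a xs \<Longrightarrow> rpath t = xs"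
  unfolding root_path_def
proof (rule the1_equality)
  assume xs: "vertex_path V E t a xs"
  then have "t \<in> V" unfolding vertex_path_def by (meson hd_in_set subsetD)
  then show "\<exists>!xs. vertex_path V E t a xs" by (rule rpath_unique)
qed

lemma rpath_root: "rpath a = [a]"
  by (rule rpath_eqI) (auto simp: vertex_path_def root_in)

text \<open>A tail of the path from \<open>t\<close> to the root is again a path to the root, hence the only one from its
  first vertex. All order properties of the tree are read off from this.\<close>

lemma rpath_split:
  assumes "t \<in> V" "rpath t = ys @ s # zs"
  shows "rpath s = s # zs" "s \<in> V"
proof -
  have p: "vertex_path V E s a (s # zs)"
    using vertex_path_rpath[OF assms(1)] unfolding assms(2)
    by (auto simp: vertex_path_def successively_append_iff)
  show "rpath s = s # zs" using p by (rule rpath_eqI)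
  show "s \<in> V" using p by (simp add: vertex_path_def)
qed

lemma suffix_rpath:
  assumes "t \<in> V" "s \<in> set (rpath t)"
  shows "suffix (rpath s) (rpath t)" "s \<in> V"
proof -
  obtain ys zs where yz: "rpath t = ys @ s # zs" using assms(2) by (blast dest: split_list)
  show "suffix (rpath s) (rpath t)" "s \<in> V"
    using rpath_split[OF assms(1) yz] yz by (simp_all add: suffix_def)
qed

lemma rpath_Cons: "t \<in> V \<Longrightarrow> \<exists>zs. rpath t = t # zs"
  using vertex_path_rpath[of t] by (cases "rpath t") (auto simp: vertex_path_def)

lemma distinct_rpath: "t \<in> V \<Longrightarrow> distinct (rpath t)"
  using vertex_path_rpath[of t] by (auto simp: vertex_path_def)

lemma height_eq:
  assumes "t \<in> V"
  shows "height V E a t + 1 = length (rpath t)"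
proof -
  obtain zs where zs: "rpath t = t # zs" using rpath_Cons[OF assms] by blast
  have "{r \<in> V. tree_le V E a r t \<and> r \<noteq> t} = set zs"
    using zs assms distinct_rpath[OF assms] suffix_rpath[OF assms] by (auto simp: tree_le_def)
  then show ?thesis
    using distinct_rpath[OF assms] zs by (simp add: height_def distinct_card)
qed

lemma rpath_parent:
  assumes "t \<in> V" "t \<noteq> a"
  shows "rpath t = t # rpath (par t)" "par t \<in> V"
proof -
  obtain zs where zs: "rpath t = t # zs" using rpath_Cons[OF assms(1)] by blast
  then have "zs \<noteq> []"
    using vertex_path_rpath[OF assms(1)] assms(2) by (auto simp: vertex_path_def)
  then obtain q ws where ws: "zs = q # ws" by (cases zs) auto
  have q: "rpath q = zs" "q \<in> V"
    using rpath_split[OF assms(1), of "[t]" q ws] zs ws by auto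
  have "par t = q"
    unfolding parent_def
  proof (rule the_equality)
    show "tree_le V E a q t \<and> height V E a t = height V E a q + 1"
      using q zs ws assms height_eq[of q] height_eq[of t] by (auto simp: tree_le_def)
    fix s assume s: "tree_le V E a s t \<and> height V E a t = height V E a s + 1"
    then have sV: "s \<in> V" and su: "suffix (rpath s) (rpath t)"
      using suffix_rpath[OF assms(1)] by (auto simp: tree_le_def)
    have "length (rpath s) = length (rpath q)"
      using s height_eq[OF sV] height_eq[OF assms(1)] zs q by simp
    moreover have "suffix (rpath q) (rpath t)" using zs q by (simp add: suffix_ConsI)
    ultimately have "rpath s = rpath q"
      using su suffix_length_suffix[of "rpath s" "rpath t" "rpath q"] by (auto simp: suffix_def)
    then show "s = q" using rpath_Cons[OF sV] rpath_Cons[OF q(2)] by force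
  qed
  with q zs show "rpath t = t # rpath (par t)" "par t \<in> V" by auto
qed

lemma parent_neq: "t \<in> V \<Longrightarrow> t \<noteq> a \<Longrightarrow> par t \<noteq> t"
  using rpath_parent by (metis not_Cons_self2)

lemma mem_desc_iff: "k \<in> desc t \<longleftrightarrow> k \<in> V \<and> t \<in> set (rpath k)"
  using suffix_rpath by (auto simp: descendants_def tree_le_def)

lemma desc_subset: "desc t \<subseteq> V"
  by (auto simp: mem_desc_iff)

lemma self_in_desc: "t \<in> V \<Longrightarrow> t \<in> desc t"
  using rpath_Cons[of t] by (auto simp: mem_desc_iff)

lemma desc_root: "desc a = V"
proof -
  have "a \<in> set (rpath t)" if "t \<in> V" for t
    using vertex_path_rpath[OF that] unfolding vertex_path_def by (metis last_in_set)
  then show ?thesis by (auto simp: mem_desc_iff)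
qed

lemma desc_trans: "s \<in> desc t \<Longrightarrow> desc s \<subseteq> desc t"
  using suffix_rpath(1) set_mono_suffix by (fastforce simp: mem_desc_iff)

lemma rpath_length_le: "k \<in> desc t \<Longrightarrow> length (rpath t) \<le> length (rpath k)"
  using suffix_rpath by (auto simp: mem_desc_iff dest: suffix_length_le)

text \<open>Two ancestors of one vertex lie on its single path to the root, so the one with the shorter
  path is an ancestor of the other.\<close>

lemma ancestors_comparable:
  assumes "k \<in> desc s" "k \<in> desc t" "length (rpath s) \<le> length (rpath t)"
  shows "t \<in> desc s"
proof -
  have "suffix (rpath s) (rpath k)" "suffix (rpath t) (rpath k)" and V: "s \<in> V" "t \<in> V"
    using assms suffix_rpath by (auto simp: mem_desc_iff)
  then have "suffix (rpath s) (rpath t)" using assms(3) by (metis suffix_length_suffix)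
  then show ?thesis using rpath_Cons[OF V(1)] V by (auto simp: mem_desc_iff dest!: set_mono_suffix)
qed

lemma desc_same_length:
  assumes "t \<in> desc s" "length (rpath t) = length (rpath s)"
  shows "t = s"
proof -
  have V: "s \<in> V" "t \<in> V" and "suffix (rpath s) (rpath t)"
    using assms suffix_rpath by (auto simp: mem_desc_iff)
  then have "rpath s = rpath t" using assms(2) by (auto simp: suffix_def)
  then show ?thesis using rpath_Cons[OF V(1)] rpath_Cons[OF V(2)] by auto
qed

lemma children_iff: "s \<in> chld t \<longleftrightarrow> s \<in> V - {a} \<and> par s = t"
  by (auto simp: children_def)

lemma child_not_ancestor:
  assumes "s \<in> chld t"
  shows "t \<notin> desc s"
  using assms rpath_parent(1)[of s] rpath_length_le[of t s] by (auto simp: children_iff)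

lemma disjoint_desc_children: "disjoint_family_on desc (chld t)"
proof (unfold disjoint_family_on_def, intro ballI impI)
  fix r s assume rs: "r \<in> chld t" "s \<in> chld t" "r \<noteq> s"
  have len: "length (rpath r) = length (rpath s)"
    using rs rpath_parent(1)[of s] rpath_parent(1)[of r] by (simp add: children_iff)
  { fix k assume "k \<in> desc r" "k \<in> desc s"
    then have "s \<in> desc r" using ancestors_comparable[of k r s] len by simp
    then have "s = r" using desc_same_length[of s r] len by simp }
  then show "desc r \<inter> desc s = {}" using rs(3) by auto
qed

text \<open>On the path from a proper descendant to the root, the vertex just before \<open>t\<close> is a child of \<open>t\<close>.\<close>

lemma desc_unfold:
  assumes "t \<in> V"
  shows "desc t = insert t (\<Union>s\<in>chld t. desc s)"
proof
  show "insert t (\<Union>s\<in>chld t. desc s) \<subseteq> desc t"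
  proof -
    have "s \<in> desc t" if "s \<in> chld t" for s
      using that rpath_parent[of s] rpath_Cons[of t] assms by (auto simp: children_iff mem_desc_iff)
    then show ?thesis using self_in_desc[OF assms] desc_trans by blast
  qed
  show "desc t \<subseteq> insert t (\<Union>s\<in>chld t. desc s)"
  proof
    fix k assume k: "k \<in> desc t"
    show "k \<in> insert t (\<Union>s\<in>chld t. desc s)"
    proof (cases "k = t")
      case False
      obtain ys zs where yz: "rpath k = ys @ t # zs" and kV: "k \<in> V"
        using k by (auto simp: mem_desc_iff dest: split_list)
      then have "ys \<noteq> []" using rpath_Cons[OF kV] False by auto
      then obtain xs s where xs: "ys = xs @ [s]" by (cases ys rule: rev_cases) auto
      then have s: "rpath s = s # t # zs" "s \<in> V"
        using rpath_split[OF kV, of xs s "t # zs"] yz by auto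
      have "s \<noteq> a" using s rpath_root by auto
      then have "t # zs = rpath (par s)" "par s \<in> V" using rpath_parent[OF s(2)] s(1) by auto
      then have "par s = t" using rpath_Cons[of "par s"] by auto
      then have "s \<in> chld t" using s \<open>s \<noteq> a\<close> by (simp add: children_iff)
      moreover have "k \<in> desc s" using yz xs kV by (simp add: mem_desc_iff)
      ultimately show ?thesis by blast
    qed simp
  qed
qed

text \<open>The elements of \<open>S\<close> closest to the root: they play the part of the disjoint balls selected
  by a covering lemma.\<close>

definition minimal_in :: "'v set \<Rightarrow> 'v set" where
  "minimal_in S = {t \<in> S. \<forall>s\<in>S. t \<in> desc s \<longrightarrow> s = t}"

lemma minimal_in_exists:
  assumes "S \<subseteq> V" "t \<in> S"
  shows "\<exists>m\<in>minimal_in S. t \<in> desc m"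
proof -
  let ?P = "\<lambda>s. s \<in> S \<and> t \<in> desc s"
  obtain m where m: "?P m" "\<And>s. ?P s \<Longrightarrow> length (rpath m) \<le> length (rpath s)"
    using ex_has_least_nat[of ?P t "\<lambda>s. length (rpath s)"] assms self_in_desc by blast
  have "s = m" if "s \<in> S" "m \<in> desc s" for s
  proof -
    have "length (rpath m) \<le> length (rpath s)" using m that desc_trans by blast
    then have "length (rpath m) = length (rpath s)" using rpath_length_le[OF that(2)] by simp
    then show ?thesis using desc_same_length[OF that(2)] by simp
  qed
  then have "m \<in> minimal_in S" using m(1) unfolding minimal_in_def by blast
  then show ?thesis using m(1) by blast
qed

lemma disjoint_desc_minimal: "disjoint_family_on desc (minimal_in S)"
proof (unfold disjoint_family_on_def, intro ballI impI)
  fix r s assume rs: "r \<in> minimal_in S" "s \<in> minimal_in S" "r \<noteq> s"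
  have "r \<in> desc s \<or> s \<in> desc r" if "k \<in> desc r" "k \<in> desc s" for k
    using ancestors_comparable[of k r s] ancestors_comparable[of k s r] that by linarith
  moreover have "r \<notin> desc s" "s \<notin> desc r" using rs unfolding minimal_in_def by blast+
  ultimately show "desc r \<inter> desc s = {}" by blast
qed

end

section \<open>Unordered sums as integrals over counting measure\<close>

lemma summable_on_iff_integrable_count_space:
  fixes f :: "'i \<Rightarrow> real"
  shows "f summable_on I \<longleftrightarrow> integrable (count_space I) f"
  using summable_on_iff_abs_summable_on_real[of f I] abs_summable_equivalent[of f I]
  by (simp only: abs_summable_on_def)

text \<open>A family that is not summable is not integrable either, and both sides are then 0 by convention.
  The identity makes measurability of sums and their exchange with integrals instances of Fubini's
  theorem.\<close>

lemma infsum_eq_integral_count_space: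
  fixes f :: "'i \<Rightarrow> real"
  shows "infsum f I = (\<integral>i. f i \<partial>count_space I)"
proof (cases "f summable_on I")
  case True
  then have "Infinite_Set_Sum.abs_summable_on f I"
    using summable_on_iff_abs_summable_on_real[of f I] abs_summable_equivalent[of f I] by blast
  from infsetsum_infsum[OF this] show ?thesis by (simp add: infsetsum_def)
next
  case False
  then show ?thesis
    by (simp add: infsum_not_exists not_integrable_integral_eq summable_on_iff_integrable_count_space)
qed

text \<open>For an infinite index set both sides are suprema of finite partial sums: of all of them on the
  left, of those along an enumeration on the right.\<close>

lemma infsum_ennreal_eq_nn_integral_count_space:
  fixes f :: "'i \<Rightarrow> ennreal"
  assumes "countable I"
  shows "infsum f I = (\<integral>\<^sup>+i. f i \<partial>count_space I)"
proof (rule antisym)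
  have inf: "infsum f I = (SUP F\<in>{F. finite F \<and> F \<subseteq> I}. sum f F)"
    by (rule nonneg_infsum_complete) simp
  show "infsum f I \<le> (\<integral>\<^sup>+i. f i \<partial>count_space I)"
    unfolding inf
  proof (rule SUP_least, clarify)
    fix F assume F: "finite F" "F \<subseteq> I"
    have "sum f F = (\<integral>\<^sup>+i. f i * indicator F i \<partial>count_space I)"
      using F by (subst nn_integral_count_space'[of F]) auto
    also have "\<dots> \<le> (\<integral>\<^sup>+i. f i \<partial>count_space I)"
      by (intro nn_integral_mono) (simp split: split_indicator)
    finally show "sum f F \<le> (\<integral>\<^sup>+i. f i \<partial>count_space I)" .
  qed
  show "(\<integral>\<^sup>+i. f i \<partial>count_space I) \<le> infsum f I"
  proof (cases "finite I")
    case True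
    then show ?thesis by (simp add: nn_integral_count_space_finite)
  next
    case False
    define e where "e = from_nat_into I"
    have e: "bij_betw e UNIV I"
      using bij_betw_from_nat_into[OF assms False] by (simp add: e_def)
    have "(\<integral>\<^sup>+i. f i \<partial>count_space I) = (\<integral>\<^sup>+n. f (e n) \<partial>count_space UNIV)"
      by (rule nn_integral_bij_count_space[OF e, symmetric])
    also have "\<dots> = (SUP n. \<Sum>k<n. f (e k))"
      by (simp add: nn_integral_count_space_nat suminf_eq_SUP)
    also have "\<dots> \<le> infsum f I"
    proof (rule SUP_least)
      fix n
      have "(\<Sum>k<n. f (e k)) = sum f (e ` {..<n})"
        using e by (subst sum.reindex) (auto simp: bij_betw_def inj_on_def)
      also have "\<dots> \<le> infsum f I"
        unfolding inf using e by (intro SUP_upper) (auto simp: bij_betw_def)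
      finally show "(\<Sum>k<n. f (e k)) \<le> infsum f I" .
    qed
    finally show ?thesis .
  qed
qed

lemma borel_measurable_infsum:
  fixes h :: "'i \<Rightarrow> 'b \<Rightarrow> real"
  assumes "countable I" "\<And>i. i \<in> I \<Longrightarrow> h i \<in> borel_measurable M"
  shows "(\<lambda>x. \<Sum>\<^sub>\<infinity>i\<in>I. h i x) \<in> borel_measurable M"
proof -
  interpret sigma_finite_measure "count_space I"
    by (rule sigma_finite_measure_count_space_countable[OF assms(1)])
  have "(\<lambda>(x, i). h i x) \<in> borel_measurable (M \<Otimes>\<^sub>M count_space I)"
  proof (subst measurable_pair_swap_iff)
    show "(\<lambda>(y, x). case (x, y) of (x, i) \<Rightarrow> h i x) \<in> borel_measurable (count_space I \<Otimes>\<^sub>M M)"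
      by (rule measurable_pair_measure_countable1) (use assms in auto)
  qed
  from borel_measurable_lebesgue_integral[OF this] show ?thesis
    by (simp add: infsum_eq_integral_count_space)
qed

lemma has_bochner_integral_infsum:
  fixes h :: "'i \<Rightarrow> 'b \<Rightarrow> real"
  assumes "sigma_finite_measure M" "countable I"
    and h: "\<And>i. i \<in> I \<Longrightarrow> h i \<in> borel_measurable M"
    and fin: "(\<integral>\<^sup>+i. \<integral>\<^sup>+x. ennreal \<bar>h i x\<bar> \<partial>M \<partial>count_space I) < \<infinity>"
  shows "has_bochner_integral M (\<lambda>x. \<Sum>\<^sub>\<infinity>i\<in>I. h i x) (\<Sum>\<^sub>\<infinity>i\<in>I. integral\<^sup>L M (h i))"
    and "(\<lambda>i. integral\<^sup>L M (h i)) summable_on I"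
proof -
  interpret M: sigma_finite_measure M by fact
  interpret C: sigma_finite_measure "count_space I"
    by (rule sigma_finite_measure_count_space_countable[OF assms(2)])
  interpret P: pair_sigma_finite "count_space I" M ..
  have meas: "(\<lambda>(i, x). h i x) \<in> borel_measurable (count_space I \<Otimes>\<^sub>M M)"
    by (rule measurable_pair_measure_countable1) (use assms in auto)
  have "(\<integral>\<^sup>+z. ennreal (norm (case z of (i, x) \<Rightarrow> h i x)) \<partial>(count_space I \<Otimes>\<^sub>M M))
      = (\<integral>\<^sup>+i. \<integral>\<^sup>+x. ennreal \<bar>h i x\<bar> \<partial>M \<partial>count_space I)"
    using meas by (subst M.nn_integral_fst[symmetric]) (auto simp: case_prod_unfold)
  then have int: "integrable (count_space I \<Otimes>\<^sub>M M) (\<lambda>(i, x). h i x)"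
    using meas fin by (simp add: integrable_iff_bounded)
  show "(\<lambda>i. integral\<^sup>L M (h i)) summable_on I"
    unfolding summable_on_iff_integrable_count_space using P.integrable_fst[OF int] by simp
  show "has_bochner_integral M (\<lambda>x. \<Sum>\<^sub>\<infinity>i\<in>I. h i x) (\<Sum>\<^sub>\<infinity>i\<in>I. integral\<^sup>L M (h i))"
    unfolding infsum_eq_integral_count_space has_bochner_integral_iff
    using P.integrable_snd[OF int] P.Fubini_integral[OF int] by simp
qed

lemma nn_integral_count_space_disjoint_indicator:
  assumes "disjoint_family_on A I"
  shows "(\<integral>\<^sup>+i. indicator (A i) x \<partial>count_space I) = (indicator (\<Union>i\<in>I. A i) x :: ennreal)"
proof (cases "\<exists>i\<in>I. x \<in> A i")
  case True
  then obtain j where j: "j \<in> I" "x \<in> A j" by blast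
  have "(\<integral>\<^sup>+i. indicator (A i) x \<partial>count_space I) = (\<Sum>i\<in>{j}. indicator (A i) x :: ennreal)"
    using assms j by (intro nn_integral_count_space') (auto simp: disjoint_family_on_def indicator_def)
  then show ?thesis using j by (auto simp: indicator_def)
next
  case False
  then have "(\<integral>\<^sup>+i. indicator (A i) x \<partial>count_space I) = (\<integral>\<^sup>+i. 0 \<partial>count_space I :: ennreal)"
    by (intro nn_integral_cong) (auto simp: indicator_def)
  then show ?thesis using False by simp
qed

lemma emeasure_UN_le_nn_integral_count_space:
  assumes "countable I" and [measurable]: "\<And>i. i \<in> I \<Longrightarrow> A i \<in> sets M"
  shows "emeasure M (\<Union>i\<in>I. A i) \<le> (\<integral>\<^sup>+i. emeasure M (A i) \<partial>count_space I)"
proof -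
  have [measurable]: "(\<Union>i\<in>I. A i) \<in> sets M" using assms by (intro sets.countable_UN') auto
  have "emeasure M (\<Union>i\<in>I. A i) = (\<integral>\<^sup>+x. indicator (\<Union>i\<in>I. A i) x \<partial>M)"
    by simp
  also have "\<dots> \<le> (\<integral>\<^sup>+x. \<integral>\<^sup>+i. indicator (A i) x \<partial>count_space I \<partial>M)"
  proof (rule nn_integral_mono)
    fix x
    show "(indicator (\<Union>i\<in>I. A i) x :: ennreal) \<le> (\<integral>\<^sup>+i. indicator (A i) x \<partial>count_space I)"
      using nn_integral_ge_point[of _ I "\<lambda>i. indicator (A i) x"] by (force simp: indicator_def)
  qed
  also have "\<dots> = (\<integral>\<^sup>+i. \<integral>\<^sup>+x. indicator (A i) x \<partial>M \<partial>count_space I)"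
    by (rule nn_integral_count_space_nn_integral[OF assms(1)]) simp
  also have "\<dots> = (\<integral>\<^sup>+i. emeasure M (A i) \<partial>count_space I)"
    by (intro nn_integral_cong) simp
  finally show ?thesis .
qed

lemma has_sum_single:
  fixes f :: "'i \<Rightarrow> 'b::{comm_monoid_add, t2_space}"
  assumes "j \<in> I" "\<And>i. i \<in> I \<Longrightarrow> i \<noteq> j \<Longrightarrow> f i = 0"
  shows "(f has_sum f j) I"
proof -
  have "(f has_sum f j) I \<longleftrightarrow> (f has_sum f j) {j}"
    using assms by (intro has_sum_cong_neutral) auto
  then show ?thesis using has_sum_finite[of "{j}" f] by simp
qed

lemma has_sum_diff:
  fixes f g :: "'i \<Rightarrow> real"
  assumes "(f has_sum x) I" "(g has_sum y) I"
  shows "((\<lambda>i. f i - g i) has_sum (x - y)) I"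
  using has_sum_add[OF assms(1), of "\<lambda>i. - g i" "- y"] assms(2) by (simp add: has_sum_uminus)

section \<open>Tree coverings and the weak type estimate\<close>

text \<open>All integrals are taken over \<open>\<Omega>\<close>, which has finite measure; functions that vanish off a
  smaller domain do not see the difference.\<close>

locale tree_covering = rooted_tree_at V E a
  for V :: "'v set" and E :: "'v \<Rightarrow> 'v \<Rightarrow> bool" and a :: 'v +
  fixes \<Omega> :: "'b::euclidean_space set" and U B :: "'v \<Rightarrow> 'b set" and N :: real
  assumes domain: "is_domain \<Omega>" and bounded: "bounded \<Omega>" and countable: "countable V"
    and subdomain: "\<And>t. t \<in> V \<Longrightarrow> is_domain (U t) \<and> U t \<subseteq> \<Omega>"
    and overlap: "overlap_condition V U \<Omega> N"
    and bridge: "bridge_condition V E a U B"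
begin

abbreviation "M \<equiv> lebesgue_on \<Omega>"
abbreviation "W \<equiv> shadow V E a U"

lemma sets_Omega: "\<Omega> \<in> sets lebesgue"
  using domain by (auto simp: is_domain_def)

lemma space_M: "space M = \<Omega>"
  by simp

lemma sets_M_iff: "A \<in> sets M \<longleftrightarrow> A \<in> sets lebesgue \<and> A \<subseteq> \<Omega>"
  using sets_Omega by (auto simp: sets_restrict_space_iff)

lemma emeasure_M: "A \<subseteq> \<Omega> \<Longrightarrow> emeasure M A = emeasure lebesgue A"
  using sets_Omega by (simp add: emeasure_restrict_space)

lemma Omega_lmeasurable: "\<Omega> \<in> lmeasurable"
  using domain bounded by (simp add: is_domain_def lmeasurable_open)

sublocale finite_measure M
  by (rule finite_measure_lebesgue_on[OF Omega_lmeasurable])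

lemma U_subset_W: "t \<in> V \<Longrightarrow> U t \<subseteq> W t"
  unfolding shadow_def using self_in_desc by blast

lemma W_subset: "W t \<subseteq> \<Omega>"
  unfolding shadow_def using subdomain desc_subset by blast

lemma W_open: "open (W t)"
  unfolding shadow_def using subdomain desc_subset by (intro open_UN) (auto simp: is_domain_def)

lemma W_sets [measurable]: "W t \<in> sets M"
  using W_open W_subset by (simp add: sets_M_iff)

lemma U_sets: "t \<in> V \<Longrightarrow> U t \<in> sets M"
  using subdomain[of t] by (auto simp: sets_M_iff is_domain_def)

lemma B_subset: "t \<in> V - {a} \<Longrightarrow> B t \<subseteq> U t \<inter> U (par t)"
  using bridge by (auto simp: bridge_condition_def)

lemma B_subset_W: "t \<in> V - {a} \<Longrightarrow> B t \<subseteq> W t"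
  using B_subset[of t] U_subset_W[of t] by auto

lemma B_sets: "t \<in> V - {a} \<Longrightarrow> B t \<in> sets M"
  using bridge B_subset_W[of t] W_subset[of t] by (auto simp: sets_M_iff bridge_condition_def)

lemma disjoint_B: "disjoint_family_on B (V - {a})"
  using bridge by (auto simp: bridge_condition_def)

lemma measure_lebesgue_eq: "A \<subseteq> \<Omega> \<Longrightarrow> measure lebesgue A = measure M A"
  by (simp add: measure_def emeasure_M)

lemma measure_B_pos: "t \<in> V - {a} \<Longrightarrow> 0 < measure M (B t)"
proof -
  assume t: "t \<in> V - {a}"
  have "0 < emeasure lebesgue (B t)"
    using bridge t unfolding bridge_condition_def by blast
  also have "\<dots> = emeasure M (B t)"
    using B_subset_W[OF t] W_subset[of t] by (intro emeasure_M[symmetric]) blast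
  finally have "0 < emeasure M (B t)" .
  then show ?thesis by (simp add: emeasure_eq_measure)
qed

lemma measure_B_le_W: "t \<in> V - {a} \<Longrightarrow> measure M (B t) \<le> measure M (W t)"
  by (intro finite_measure_mono B_subset_W W_sets)

lemma measure_W_pos: "t \<in> V - {a} \<Longrightarrow> 0 < measure M (W t)"
  using measure_B_pos measure_B_le_W by fastforce

lemma overlap_AE:
  "AE x in M. (\<integral>\<^sup>+t. indicator (U t) x \<partial>count_space V) \<le> ennreal N"
proof -
  have "AE x in lebesgue. x \<in> \<Omega> \<longrightarrow> (\<integral>\<^sup>+t. indicator (U t) x \<partial>count_space V) \<le> ennreal N"
    using overlap unfolding overlap_condition_def
    by eventually_elim (auto simp: infsum_ennreal_eq_nn_integral_count_space[OF countable])
  then show ?thesis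
    using sets_Omega by (subst AE_restrict_space_iff) auto
qed

text \<open>A nonempty open set is not negligible. This is what excludes degenerate constants: it forces
  \<open>N \<ge> 1\<close> below, and later a positive norm of the embedding between the two weighted spaces.\<close>

lemma Omega_not_null: "\<not> (AE x in lebesgue. x \<notin> \<Omega>)"
proof
  assume "AE x in lebesgue. x \<notin> \<Omega>"
  then have "emeasure lebesgue \<Omega> = 0"
    using sets_Omega by (subst (asm) AE_iff_measurable[of \<Omega>]) auto
  then have "negligible \<Omega>" using sets_Omega by (auto simp: negligible_iff_null_sets)
  then show False using domain open_not_negligible by (auto simp: is_domain_def)
qed

lemma N_ge_1: "1 \<le> N"
proof (rule ccontr)
  assume "\<not> 1 \<le> N"
  then have N: "ennreal N < 1" by (simp add: ennreal_less_one_iff)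
  have "AE x in lebesgue. x \<notin> \<Omega>"
    using overlap unfolding overlap_condition_def
  proof eventually_elim
    case (elim x)
    then have "indicator \<Omega> x \<le> ennreal N * indicator \<Omega> x" by (metis order_trans)
    then show ?case using N by (auto simp: indicator_def)
  qed
  then show False using Omega_not_null by blast
qed

text \<open>Every bridge of \<open>S\<close> lies in the shadow of a minimal element of \<open>S\<close>. The minimal elements
  have disjoint subtrees, so shadows of different minimal elements are unions over disjoint parts
  of the covering, and almost every point lies in at most \<open>N\<close> of these shadows.\<close>

lemma sum_bridges_le:
  assumes S: "S \<subseteq> V - {a}" and h [measurable]: "h \<in> borel_measurable M"
    and avg: "\<And>t. t \<in> S \<Longrightarrow> c * emeasure M (W t) \<le> (\<integral>\<^sup>+x. h x * indicator (W t) x \<partial>M)"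
  shows "c * (\<integral>\<^sup>+t. emeasure M (B t) \<partial>count_space S) \<le> ennreal N * (\<integral>\<^sup>+x. h x \<partial>M)"
proof -
  let ?m = "minimal_in S"
  have m: "?m \<subseteq> S" by (auto simp: minimal_in_def)
  have cS: "countable S" and cm: "countable ?m"
    using S m countable by (meson countable_subset Diff_subset order_trans)+
  have BS: "B t \<in> sets M" if "t \<in> S" for t using B_sets that S by blast
  have "(\<integral>\<^sup>+t. emeasure M (B t) \<partial>count_space S) = emeasure M (\<Union>t\<in>S. B t)"
    using S disjoint_B by (intro emeasure_UN_countable[symmetric] BS cS)
      (auto intro: disjoint_family_on_mono)
  also have "\<dots> \<le> emeasure M (\<Union>t\<in>?m. W t)"
  proof (rule emeasure_mono)
    show "(\<Union>t\<in>S. B t) \<subseteq> (\<Union>t\<in>?m. W t)"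
    proof (rule UN_least)
      fix t assume t: "t \<in> S"
      obtain s where s: "s \<in> ?m" "t \<in> desc s" using minimal_in_exists[of S t] S t by blast
      have "W t \<subseteq> W s" unfolding shadow_def using desc_trans[OF s(2)] by blast
      then show "B t \<subseteq> (\<Union>t\<in>?m. W t)" using B_subset_W[of t] t S s(1) by blast
    qed
    show "(\<Union>t\<in>?m. W t) \<in> sets M" using cm by (intro sets.countable_UN') auto
  qed
  also have "\<dots> \<le> (\<integral>\<^sup>+t. emeasure M (W t) \<partial>count_space ?m)"
    using cm by (intro emeasure_UN_le_nn_integral_count_space) auto
  finally have "c * (\<integral>\<^sup>+t. emeasure M (B t) \<partial>count_space S)
      \<le> c * (\<integral>\<^sup>+t. emeasure M (W t) \<partial>count_space ?m)"
    by (rule mult_left_mono) simp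
  also have "\<dots> = (\<integral>\<^sup>+t. c * emeasure M (W t) \<partial>count_space ?m)"
    by (rule nn_integral_cmult[symmetric]) simp
  also have "\<dots> \<le> (\<integral>\<^sup>+t. \<integral>\<^sup>+x. h x * indicator (W t) x \<partial>M \<partial>count_space ?m)"
    using avg m by (intro nn_integral_mono) auto
  also have "\<dots> = (\<integral>\<^sup>+x. \<integral>\<^sup>+t. h x * indicator (W t) x \<partial>count_space ?m \<partial>M)"
    by (rule nn_integral_count_space_nn_integral[symmetric, OF cm]) measurable
  also have "\<dots> \<le> (\<integral>\<^sup>+x. ennreal N * h x \<partial>M)"
  proof (rule nn_integral_mono_AE)
    show "AE x in M. (\<integral>\<^sup>+t. h x * indicator (W t) x \<partial>count_space ?m) \<le> ennreal N * h x"
      using overlap_AE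
    proof eventually_elim
      case (elim x)
      \<comment> \<open>A shadow containing \<open>x\<close> is charged to a subdomain of its subtree containing \<open>x\<close>; disjointness
        of the subtrees prevents a subdomain from being charged twice.\<close>
      have "(\<integral>\<^sup>+t. indicator (W t) x \<partial>count_space ?m)
          \<le> (\<integral>\<^sup>+t. \<integral>\<^sup>+k. indicator (desc t) k * indicator (U k) x \<partial>count_space V \<partial>count_space ?m)"
      proof (rule nn_integral_mono)
        fix t
        show "(indicator (W t) x :: ennreal)
          \<le> (\<integral>\<^sup>+k. indicator (desc t) k * indicator (U k) x \<partial>count_space V)"
        proof (cases "x \<in> W t")
          case True
          then obtain k where k: "k \<in> desc t" "x \<in> U k" by (auto simp: shadow_def)
          then show ?thesis
            using nn_integral_ge_point[of k V "\<lambda>k. indicator (desc t) k * indicator (U k) x"]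
              desc_subset True by auto
        qed simp
      qed
      also have "\<dots> = (\<integral>\<^sup>+k. \<integral>\<^sup>+t. indicator (desc t) k * indicator (U k) x \<partial>count_space ?m \<partial>count_space V)"
        by (rule nn_integral_count_space_nn_integral[symmetric, OF cm]) simp
      also have "\<dots> = (\<integral>\<^sup>+k. (\<integral>\<^sup>+t. indicator (desc t) k \<partial>count_space ?m) * indicator (U k) x \<partial>count_space V)"
        by (intro nn_integral_cong nn_integral_multc) simp
      also have "\<dots> \<le> (\<integral>\<^sup>+k. indicator (U k) x \<partial>count_space V)"
      proof (rule nn_integral_mono)
        fix k
        have "(\<integral>\<^sup>+t. indicator (desc t) k \<partial>count_space ?m) \<le> (1 :: ennreal)"
          unfolding nn_integral_count_space_disjoint_indicator[OF disjoint_desc_minimal]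
          by (simp add: indicator_def)
        from mult_right_mono[OF this, of "indicator (U k) x"]
        show "(\<integral>\<^sup>+t. indicator (desc t) k \<partial>count_space ?m) * indicator (U k) x
          \<le> (indicator (U k) x :: ennreal)" by simp
      qed
      also have "\<dots> \<le> ennreal N" by (rule elim)
      finally have le: "(\<integral>\<^sup>+t. indicator (W t) x \<partial>count_space ?m) \<le> ennreal N" .
      have "(\<integral>\<^sup>+t. h x * indicator (W t) x \<partial>count_space ?m)
          = h x * (\<integral>\<^sup>+t. indicator (W t) x \<partial>count_space ?m)"
        by (rule nn_integral_cmult) simp
      also have "\<dots> \<le> h x * ennreal N" by (rule mult_left_mono[OF le]) simp
      finally show ?case by (simp add: mult.commute)
    qed
  qed
  also have "\<dots> = ennreal N * (\<integral>\<^sup>+x. h x \<partial>M)" by (rule nn_integral_cmult) simp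
  finally show ?thesis .
qed

end

section \<open>Averages over shadows: the strong type estimate\<close>

lemma nn_integral_powr_Icc:
  fixes A r :: real
  assumes "0 \<le> A" "0 < r"
  shows "(\<integral>\<^sup>+l. ennreal (l powr (r - 1)) * indicator {0..A} l \<partial>lborel) = ennreal (A powr r / r)"
  using nn_integral_has_integral_lebesgue'[OF _ has_integral_powr_from_0[of "r - 1" A]] assms by simp

context tree_covering
begin

lemma Int_space_M: "A \<in> sets M \<Longrightarrow> A \<inter> space M \<in> sets M"
  by (simp only: sets.Int_space_eq2)

lemma lebesgue_on_subset: "A \<in> sets M \<Longrightarrow> lebesgue_on A = restrict_space M A"
  using sets_Omega by (subst restrict_restrict_space) (auto simp: sets_M_iff Int_absorb1)

definition avg :: "('b \<Rightarrow> real) \<Rightarrow> 'v \<Rightarrow> real" where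
  "avg f t = (\<integral>y. \<bar>f y\<bar> \<partial>lebesgue_on (W t)) / measure lebesgue (W t)"

lemma avg_nonneg: "0 \<le> avg f t"
  by (simp add: avg_def)

lemma avg_mult_measure:
  assumes "integrable M f" "t \<in> V - {a}"
  shows "ennreal (avg f t * measure M (W t)) = (\<integral>\<^sup>+x. ennreal \<bar>f x\<bar> * indicator (W t) x \<partial>M)"
proof -
  have "W t \<inter> space M \<in> sets M" by (rule Int_space_M[OF W_sets])
  then have "integrable (lebesgue_on (W t)) (\<lambda>y. \<bar>f y\<bar>)"
    unfolding lebesgue_on_subset[OF W_sets]
    using assms(1) integrable_mult_indicator[OF W_sets, of "\<lambda>y. \<bar>f y\<bar>"]
    by (subst integrable_restrict_space) auto
  then have "ennreal (\<integral>y. \<bar>f y\<bar> \<partial>lebesgue_on (W t)) = (\<integral>\<^sup>+y. ennreal \<bar>f y\<bar> \<partial>lebesgue_on (W t))"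
    by (subst nn_integral_eq_integral) auto
  also have "\<dots> = (\<integral>\<^sup>+x. ennreal \<bar>f x\<bar> * indicator (W t) x \<partial>M)"
    by (subst lebesgue_on_subset[OF W_sets], subst nn_integral_restrict_space) auto
  finally show ?thesis
    using measure_W_pos[OF assms(2)] by (simp add: avg_def measure_lebesgue_eq[OF W_subset])
qed

text \<open>The part of \<open>f\<close> below \<open>l / 2\<close> contributes at most \<open>l / 2\<close> to an average, so the part above
  contributes at least the remaining \<open>l / 2\<close>.\<close>

lemma half_le_truncated_average:
  assumes f: "integrable M f" and t: "t \<in> V - {a}" and l: "0 < l" "l \<le> avg f t"
  shows "ennreal (l / 2) * emeasure M (W t)
    \<le> (\<integral>\<^sup>+x. (if l / 2 < \<bar>f x\<bar> then ennreal \<bar>f x\<bar> else 0) * indicator (W t) x \<partial>M)"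
    (is "_ \<le> ?X")
proof -
  have [measurable]: "f \<in> borel_measurable M" using f by auto
  let ?m = "measure M (W t)"
  have "ennreal (l * ?m) \<le> ennreal (avg f t * ?m)"
    using l by (intro ennreal_leI mult_right_mono) auto
  also have "\<dots> = (\<integral>\<^sup>+x. ennreal \<bar>f x\<bar> * indicator (W t) x \<partial>M)"
    by (rule avg_mult_measure[OF f t])
  also have "\<dots> \<le> (\<integral>\<^sup>+x. (if l / 2 < \<bar>f x\<bar> then ennreal \<bar>f x\<bar> else 0) * indicator (W t) x
      + ennreal (l / 2) * indicator (W t) x \<partial>M)"
    using l by (intro nn_integral_mono) (auto simp: indicator_def intro!: ennreal_leI)
  also have "\<dots> = ?X + ennreal (l / 2) * emeasure M (W t)"
    by (subst nn_integral_add) (auto simp: nn_integral_cmult_indicator)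
  also have "ennreal (l / 2) * emeasure M (W t) = ennreal (l / 2 * ?m)"
    using l unfolding emeasure_eq_measure by (intro ennreal_mult[symmetric]) auto
  finally have *: "ennreal (l * ?m) \<le> ?X + ennreal (l / 2 * ?m)" .
  show ?thesis
  proof (cases "?X")
    case (real r)
    then have "ennreal (l * ?m) \<le> ennreal (r + l / 2 * ?m)" using * l by simp
    then have "l * ?m \<le> r + l / 2 * ?m"
      using l real by (subst (asm) ennreal_le_iff) auto
    then have "ennreal (l / 2 * ?m) \<le> ennreal r" by (intro ennreal_leI) simp
    then show ?thesis using real l by (simp add: emeasure_eq_measure ennreal_mult'[symmetric])
  qed simp
qed

lemma sum_bridges_average_ge:
  assumes f: "integrable M f" and l: "0 < l"
  shows "ennreal (l / 2) * (\<integral>\<^sup>+t. emeasure M (B t) * indicator {0..avg f t} l \<partial>count_space (V - {a}))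
    \<le> ennreal N * (\<integral>\<^sup>+x. (if l / 2 < \<bar>f x\<bar> then ennreal \<bar>f x\<bar> else 0) \<partial>M)"
proof -
  have [measurable]: "f \<in> borel_measurable M" using f by auto
  let ?S = "{t \<in> V - {a}. l \<le> avg f t}"
  have "(\<integral>\<^sup>+t. emeasure M (B t) * indicator {0..avg f t} l \<partial>count_space (V - {a}))
      = (\<integral>\<^sup>+t. emeasure M (B t) * indicator {0..avg f t} l \<partial>count_space ?S)"
    using l by (intro nn_integral_count_space_eq) (auto simp: indicator_def)
  also have "\<dots> = (\<integral>\<^sup>+t. emeasure M (B t) \<partial>count_space ?S)"
    using l by (intro nn_integral_cong) (auto simp: indicator_def)
  finally show ?thesis
    using sum_bridges_le[of ?S "\<lambda>x. if l / 2 < \<bar>f x\<bar> then ennreal \<bar>f x\<bar> else 0" "ennreal (l / 2)"]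
      half_le_truncated_average[OF f _ l] by auto
qed

text \<open>Writing \<open>s\<^sup>p\<close> as the integral of \<open>p l\<^bsup>p-1\<^esup>\<close> over \<open>0 \<le> l \<le> s\<close> reduces the left side to the total
  measure of the bridges with average at least \<open>l\<close>. The weak type bound for the truncated function
  replaces it by an integral of \<open>\<bar>f\<bar>\<close> over \<open>\<bar>f\<bar> > l / 2\<close>, and exchanging the integrals leaves the
  integral of \<open>l\<^bsup>p-2\<^esup>\<close> up to \<open>2 \<bar>f\<bar>\<close>, which converges at 0 because \<open>p > 1\<close>.\<close>

lemma sum_averages_powr_le:
  assumes f: "integrable M f" and p: "1 < p"
  shows "(\<integral>\<^sup>+t. emeasure M (B t) * ennreal (avg f t powr p) \<partial>count_space (V - {a}))
    \<le> ennreal (2 powr p * N * p / (p - 1)) * (\<integral>\<^sup>+x. ennreal (\<bar>f x\<bar> powr p) \<partial>M)"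
proof -
  have [measurable]: "f \<in> borel_measurable M" using f by auto
  interpret P: pair_sigma_finite lborel M ..
  define h where "h l x = (if l / 2 < \<bar>f x\<bar> then ennreal \<bar>f x\<bar> else 0)" for l x
  have cV: "countable (V - {a})" using countable by auto
  have cake: "ennreal (A powr p)
      = (\<integral>\<^sup>+l. ennreal (p * l powr (p - 1)) * indicator {0..A} l \<partial>lborel)" if "0 \<le> A" for A
  proof -
    have "(\<integral>\<^sup>+l. ennreal (p * l powr (p - 1)) * indicator {0..A} l \<partial>lborel)
        = ennreal p * (\<integral>\<^sup>+l. ennreal (l powr (p - 1)) * indicator {0..A} l \<partial>lborel)"
      using p by (subst nn_integral_cmult[symmetric]) (auto simp: ennreal_mult mult.assoc)
    then show ?thesis
      using p nn_integral_powr_Icc[OF that, of p] by (simp add: ennreal_mult[symmetric])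
  qed
  have "(\<integral>\<^sup>+t. emeasure M (B t) * ennreal (avg f t powr p) \<partial>count_space (V - {a}))
      = (\<integral>\<^sup>+t. \<integral>\<^sup>+l. ennreal (p * l powr (p - 1)) * (emeasure M (B t) * indicator {0..avg f t} l)
          \<partial>lborel \<partial>count_space (V - {a}))"
    unfolding cake[OF avg_nonneg]
    by (intro nn_integral_cong, subst nn_integral_cmult[symmetric]) (auto simp: ac_simps)
  also have "\<dots> = (\<integral>\<^sup>+l. \<integral>\<^sup>+t. ennreal (p * l powr (p - 1)) * (emeasure M (B t) * indicator {0..avg f t} l)
          \<partial>count_space (V - {a}) \<partial>lborel)"
    by (rule nn_integral_count_space_nn_integral[symmetric, OF cV]) measurable
  also have "\<dots> \<le> (\<integral>\<^sup>+l. \<integral>\<^sup>+x. ennreal (2 * p * N * l powr (p - 2)) * indicator {0..} l * h l x \<partial>M \<partial>lborel)"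
  proof (rule nn_integral_mono)
    fix l :: real
    let ?I = "\<integral>\<^sup>+t. emeasure M (B t) * indicator {0..avg f t} l \<partial>count_space (V - {a})"
    have "(\<integral>\<^sup>+t. ennreal (p * l powr (p - 1)) * (emeasure M (B t) * indicator {0..avg f t} l)
          \<partial>count_space (V - {a})) = ennreal (p * l powr (p - 1)) * ?I"
      by (rule nn_integral_cmult) simp
    also have "\<dots> \<le> ennreal (2 * p * N * l powr (p - 2)) * indicator {0..} l * (\<integral>\<^sup>+x. h l x \<partial>M)"
    proof (cases "0 < l")
      case True
      have "l powr (p - 1) = l powr (p - 2) * l"
        using True powr_add[of l "p - 2" 1] by simp
      then have "ennreal (p * l powr (p - 1)) = ennreal (2 * p * l powr (p - 2) * (l / 2))"
        by simp
      also have "\<dots> = ennreal (2 * p * l powr (p - 2)) * ennreal (l / 2)"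
        using True p by (intro ennreal_mult) auto
      finally have "ennreal (p * l powr (p - 1)) * ?I = ennreal (2 * p * l powr (p - 2)) * (ennreal (l / 2) * ?I)"
        by (simp only: mult.assoc)
      also have "\<dots> \<le> ennreal (2 * p * l powr (p - 2)) * (ennreal N * (\<integral>\<^sup>+x. h l x \<partial>M))"
        unfolding h_def by (rule mult_left_mono[OF sum_bridges_average_ge[OF f True]]) simp
      also have "\<dots> = ennreal (2 * p * N * l powr (p - 2)) * indicator {0..} l * (\<integral>\<^sup>+x. h l x \<partial>M)"
      proof -
        have "ennreal (2 * p * N * l powr (p - 2)) = ennreal (2 * p * l powr (p - 2) * N)"
          by (simp only: mult_ac)
        also have "\<dots> = ennreal (2 * p * l powr (p - 2)) * ennreal N"
          using p N_ge_1 by (intro ennreal_mult) auto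
        finally show ?thesis using True by (simp add: mult.assoc)
      qed
      finally show ?thesis .
    next
      case False
      have "?I = 0" if "l < 0"
        using that by (simp add: indicator_def)
      \<comment> \<open>At level 0 the left side vanishes because \<open>0 powr (p - 1) = 0\<close>.\<close>
      with False show ?thesis using p by (cases "l = 0") auto
    qed
    also have "\<dots> = (\<integral>\<^sup>+x. ennreal (2 * p * N * l powr (p - 2)) * indicator {0..} l * h l x \<partial>M)"
      unfolding h_def by (rule nn_integral_cmult[symmetric]) measurable
    finally show "(\<integral>\<^sup>+t. ennreal (p * l powr (p - 1)) * (emeasure M (B t) * indicator {0..avg f t} l)
          \<partial>count_space (V - {a}))
      \<le> (\<integral>\<^sup>+x. ennreal (2 * p * N * l powr (p - 2)) * indicator {0..} l * h l x \<partial>M)" .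
  qed
  also have "\<dots> = (\<integral>\<^sup>+x. \<integral>\<^sup>+l. ennreal (2 * p * N * l powr (p - 2)) * indicator {0..} l * h l x \<partial>lborel \<partial>M)"
    unfolding h_def by (rule P.Fubini'[symmetric]) measurable
  also have "\<dots> \<le> (\<integral>\<^sup>+x. ennreal (2 powr p * N * p / (p - 1)) * ennreal (\<bar>f x\<bar> powr p) \<partial>M)"
  proof (rule nn_integral_mono)
    fix x
    have "(\<integral>\<^sup>+l. ennreal (2 * p * N * l powr (p - 2)) * indicator {0..} l * h l x \<partial>lborel)
      \<le> (\<integral>\<^sup>+l. ennreal (2 * p * N * \<bar>f x\<bar>) * (ennreal (l powr (p - 1 - 1)) * indicator {0..2 * \<bar>f x\<bar>} l) \<partial>lborel)"
    proof (rule nn_integral_mono)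
      fix l :: real
      have "ennreal (2 * p * N * l powr (p - 2)) * ennreal \<bar>f x\<bar> = ennreal (2 * p * N * l powr (p - 2) * \<bar>f x\<bar>)"
        using p N_ge_1 by (intro ennreal_mult[symmetric]) auto
      also have "\<dots> = ennreal (2 * p * N * \<bar>f x\<bar> * l powr (p - 2))"
        by (simp only: mult_ac)
      also have "\<dots> = ennreal (2 * p * N * \<bar>f x\<bar>) * ennreal (l powr (p - 1 - 1))"
        using p N_ge_1 by (subst ennreal_mult) auto
      finally show "ennreal (2 * p * N * l powr (p - 2)) * indicator {0..} l * h l x
        \<le> ennreal (2 * p * N * \<bar>f x\<bar>) * (ennreal (l powr (p - 1 - 1)) * indicator {0..2 * \<bar>f x\<bar>} l)"
        by (auto simp: h_def indicator_def)
    qed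
    also have "\<dots> = ennreal (2 * p * N * \<bar>f x\<bar>) * ennreal ((2 * \<bar>f x\<bar>) powr (p - 1) / (p - 1))"
      using p nn_integral_powr_Icc[of "2 * \<bar>f x\<bar>" "p - 1"] by (subst nn_integral_cmult) auto
    also have "\<dots> = ennreal (2 * p * N * \<bar>f x\<bar> * ((2 * \<bar>f x\<bar>) powr (p - 1) / (p - 1)))"
      using p N_ge_1 by (intro ennreal_mult[symmetric]) auto
    also have "2 * p * N * \<bar>f x\<bar> * ((2 * \<bar>f x\<bar>) powr (p - 1) / (p - 1))
        = 2 powr p * N * p / (p - 1) * \<bar>f x\<bar> powr p"
    proof (cases "f x = 0")
      case False
      have "(2 * \<bar>f x\<bar>) powr p = (2 * \<bar>f x\<bar>) powr (p - 1) * (2 * \<bar>f x\<bar>)"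
        using powr_add[of "2 * \<bar>f x\<bar>" "p - 1" 1] False by simp
      then have "2 powr p * \<bar>f x\<bar> powr p = (2 * \<bar>f x\<bar>) powr (p - 1) * (2 * \<bar>f x\<bar>)"
        by (simp add: powr_mult)
      then show ?thesis by (simp add: field_simps)
    qed simp
    also have "ennreal (2 powr p * N * p / (p - 1) * \<bar>f x\<bar> powr p)
        = ennreal (2 powr p * N * p / (p - 1)) * ennreal (\<bar>f x\<bar> powr p)"
      using p N_ge_1 by (intro ennreal_mult) auto
    finally show "(\<integral>\<^sup>+l. ennreal (2 * p * N * l powr (p - 2)) * indicator {0..} l * h l x \<partial>lborel)
      \<le> ennreal (2 powr p * N * p / (p - 1)) * ennreal (\<bar>f x\<bar> powr p)" .
  qed
  also have "\<dots> = ennreal (2 powr p * N * p / (p - 1)) * (\<integral>\<^sup>+x. ennreal (\<bar>f x\<bar> powr p) \<partial>M)"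
    by (rule nn_integral_cmult) measurable
  finally show ?thesis .
qed

end

section \<open>Cancellation and mean values of the decomposition\<close>

locale tree_decomposition = tree_covering V E a \<Omega> U B N
  for V :: "'v set" and E a and \<Omega> :: "'b::euclidean_space set" and U B N +
  fixes \<phi> :: "'v \<Rightarrow> 'b \<Rightarrow> real" and f :: "'b \<Rightarrow> real"
  assumes pou: "partition_of_unity V U \<Omega> \<phi>" and f: "integrable M f"
begin

abbreviation "lp \<equiv> local_part \<phi> f"

definition local_mass :: "'v \<Rightarrow> real" where
  "local_mass k = integral\<^sup>L M (lp k)"

text \<open>The amount of mass that the subtree at \<open>t\<close> passes on to the parent of \<open>t\<close>.\<close>

definition tail_mass :: "'v \<Rightarrow> real" where
  "tail_mass t = (\<integral>y. (\<Sum>\<^sub>\<infinity>k\<in>desc t. lp k y) \<partial>lebesgue_on (W t))"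

abbreviation "flx \<equiv> flux V E a U B \<phi> f"
abbreviation "corr \<equiv> correction V E a U B \<phi> f"
abbreviation "tp \<equiv> tree_part V E a U B \<phi> f"

lemma f_meas [measurable]: "f \<in> borel_measurable M"
  using f by auto

lemma phi_meas: "t \<in> V \<Longrightarrow> \<phi> t \<in> borel_measurable M"
  using pou by (simp add: partition_of_unity_def)

lemma phi_range: "t \<in> V \<Longrightarrow> 0 \<le> \<phi> t x" "t \<in> V \<Longrightarrow> \<phi> t x \<le> 1"
  using pou by (simp_all add: partition_of_unity_def)

lemma phi_support: "t \<in> V \<Longrightarrow> x \<notin> U t \<Longrightarrow> \<phi> t x = 0"
  using pou by (simp add: partition_of_unity_def)

lemma phi_sum: "AE x in M. ((\<lambda>t. \<phi> t x) has_sum 1) V"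
  using pou by (simp add: partition_of_unity_def)

lemma phi_nn_sum: "AE x in M. (\<integral>\<^sup>+t. ennreal (\<phi> t x) \<partial>count_space V) = 1"
  using phi_sum
proof eventually_elim
  case (elim x)
  then have "integrable (count_space V) (\<lambda>t. \<phi> t x)"
    by (simp add: summable_on_iff_integrable_count_space[symmetric] has_sum_imp_summable)
  then have "(\<integral>\<^sup>+t. ennreal (\<phi> t x) \<partial>count_space V) = ennreal (\<integral>t. \<phi> t x \<partial>count_space V)"
    using phi_range by (intro nn_integral_eq_integral) (auto simp: AE_count_space)
  also have "(\<integral>t. \<phi> t x \<partial>count_space V) = 1"
    using infsumI[OF elim] by (simp add: infsum_eq_integral_count_space)
  finally show ?case by simp
qed

lemma lp_meas: "t \<in> V \<Longrightarrow> lp t \<in> borel_measurable M"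
  using phi_meas[of t] unfolding local_part_def by measurable

text \<open>Absolute convergence, with value the integral of \<open>\<bar>f\<bar>\<close>, since the \<open>\<phi>\<^sub>k\<close> add up to 1. It justifies
  every exchange of a sum over vertices with an integral.\<close>

lemma lp_abs_integrals_finite: "(\<integral>\<^sup>+k. \<integral>\<^sup>+x. ennreal \<bar>lp k x\<bar> \<partial>M \<partial>count_space V) < \<infinity>"
proof -
  have "(\<integral>\<^sup>+k. \<integral>\<^sup>+x. ennreal \<bar>lp k x\<bar> \<partial>M \<partial>count_space V)
      = (\<integral>\<^sup>+x. \<integral>\<^sup>+k. ennreal \<bar>lp k x\<bar> \<partial>count_space V \<partial>M)"
    using lp_meas by (intro nn_integral_count_space_nn_integral[symmetric] countable) measurable
  also have "\<dots> = (\<integral>\<^sup>+x. ennreal \<bar>f x\<bar> \<partial>M)"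
  proof (rule nn_integral_cong_AE)
    show "AE x in M. (\<integral>\<^sup>+k. ennreal \<bar>lp k x\<bar> \<partial>count_space V) = ennreal \<bar>f x\<bar>"
      using phi_nn_sum
    proof eventually_elim
      case (elim x)
      have "(\<integral>\<^sup>+k. ennreal \<bar>lp k x\<bar> \<partial>count_space V) = (\<integral>\<^sup>+k. ennreal \<bar>f x\<bar> * ennreal (\<phi> k x) \<partial>count_space V)"
        using phi_range by (intro nn_integral_cong) (auto simp: local_part_def abs_mult ennreal_mult)
      also have "\<dots> = ennreal \<bar>f x\<bar> * (\<integral>\<^sup>+k. ennreal (\<phi> k x) \<partial>count_space V)"
        by (rule nn_integral_cmult) simp
      finally show ?case using elim by simp
    qed
  qed
  also have "\<dots> < \<infinity>" using f by (simp add: integrable_iff_bounded)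
  finally show ?thesis .
qed

lemma has_bochner_integral_lp_sum:
  assumes K: "K \<subseteq> V"
  shows "has_bochner_integral M (\<lambda>x. \<Sum>\<^sub>\<infinity>k\<in>K. lp k x) (\<Sum>\<^sub>\<infinity>k\<in>K. local_mass k)"
    and "local_mass summable_on K"
proof -
  have "(\<integral>\<^sup>+k. \<integral>\<^sup>+x. ennreal \<bar>lp k x\<bar> \<partial>M \<partial>count_space K)
     = (\<integral>\<^sup>+k. (\<integral>\<^sup>+x. ennreal \<bar>lp k x\<bar> \<partial>M) * indicator K k \<partial>count_space V)"
    using K by (simp add: nn_integral_restrict_space[symmetric] restrict_count_space_subset)
  also have "\<dots> \<le> (\<integral>\<^sup>+k. \<integral>\<^sup>+x. ennreal \<bar>lp k x\<bar> \<partial>M \<partial>count_space V)"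
    by (intro nn_integral_mono) (simp add: indicator_def)
  finally have fin: "(\<integral>\<^sup>+k. \<integral>\<^sup>+x. ennreal \<bar>lp k x\<bar> \<partial>M \<partial>count_space K) < \<infinity>"
    using lp_abs_integrals_finite by (rule le_less_trans)
  have cK: "countable K" using K countable by (rule countable_subset)
  have mK: "lp k \<in> borel_measurable M" if "k \<in> K" for k using lp_meas K that by blast
  show "has_bochner_integral M (\<lambda>x. \<Sum>\<^sub>\<infinity>k\<in>K. lp k x) (\<Sum>\<^sub>\<infinity>k\<in>K. local_mass k)"
    "local_mass summable_on K"
    using has_bochner_integral_infsum[OF sigma_finite_measure_axioms cK mK fin]
    by (simp_all add: local_mass_def[abs_def])
qed

lemma lp_sum_outside: "x \<notin> W t \<Longrightarrow> (\<Sum>\<^sub>\<infinity>k\<in>desc t. lp k x) = 0"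
proof (intro infsum_0)
  fix k assume x: "x \<notin> W t" and k: "k \<in> desc t"
  then have "k \<in> V" "x \<notin> U k" using desc_subset by (auto simp: shadow_def)
  then show "lp k x = 0" by (simp add: local_part_def phi_support)
qed

lemma lp_sum_AE: "AE x in M. \<bar>\<Sum>\<^sub>\<infinity>k\<in>desc t. lp k x\<bar> \<le> \<bar>f x\<bar>"
  using phi_sum
proof eventually_elim
  case (elim x)
  have s: "(\<lambda>k. \<phi> k x) summable_on V" using elim by (rule has_sum_imp_summable)
  have s': "(\<lambda>k. \<phi> k x) summable_on desc t" using s desc_subset by (rule summable_on_subset_banach)
  have "0 \<le> (\<Sum>\<^sub>\<infinity>k\<in>desc t. \<phi> k x)"
    by (intro infsum_nonneg) (use phi_range desc_subset in blast)
  moreover have "(\<Sum>\<^sub>\<infinity>k\<in>desc t. \<phi> k x) \<le> 1"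
    using infsum_mono2[OF s' s desc_subset] phi_range infsumI[OF elim] by auto
  ultimately show ?case
    unfolding local_part_def infsum_cmult_right' abs_mult by (intro mult_left_le) auto
qed

lemma tail_mass_eq: "tail_mass t = (\<integral>x. (\<Sum>\<^sub>\<infinity>k\<in>desc t. lp k x) \<partial>M)"
proof -
  have "W t \<inter> space M \<in> sets M" by (rule Int_space_M[OF W_sets])
  then have "tail_mass t = (\<integral>x. indicator (W t) x *\<^sub>R (\<Sum>\<^sub>\<infinity>k\<in>desc t. lp k x) \<partial>M)"
    unfolding tail_mass_def lebesgue_on_subset[OF W_sets] by (rule integral_restrict_space)
  also have "\<dots> = (\<integral>x. (\<Sum>\<^sub>\<infinity>k\<in>desc t. lp k x) \<partial>M)"
    using lp_sum_outside by (intro Bochner_Integration.integral_cong) (auto simp: indicator_def)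
  finally show ?thesis .
qed

lemma tail_mass_eq_mass: "tail_mass t = (\<Sum>\<^sub>\<infinity>k\<in>desc t. local_mass k)"
  unfolding tail_mass_eq using has_bochner_integral_lp_sum(1)[OF desc_subset] by (rule has_bochner_integral_integral_eq)

lemma tail_mass_abs_le:
  assumes "t \<in> V - {a}"
  shows "\<bar>tail_mass t\<bar> \<le> avg f t * measure M (W t)"
proof -
  have "ennreal \<bar>tail_mass t\<bar> \<le> (\<integral>\<^sup>+x. ennreal \<bar>\<Sum>\<^sub>\<infinity>k\<in>desc t. lp k x\<bar> \<partial>M)"
    using integral_norm_bound_ennreal[OF has_bochner_integral_lp_sum(1)[OF desc_subset, THEN integrable.intros]]
    by (simp add: tail_mass_eq)
  also have "\<dots> \<le> (\<integral>\<^sup>+x. ennreal \<bar>f x\<bar> * indicator (W t) x \<partial>M)"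
    using lp_sum_AE[of t]
    by (intro nn_integral_mono_AE, eventually_elim)
       (auto simp: indicator_def lp_sum_outside intro!: ennreal_leI)
  also have "\<dots> = ennreal (avg f t * measure M (W t))"
    using assms f by (simp add: avg_mult_measure)
  finally show ?thesis by (simp add: ennreal_le_iff avg_nonneg)
qed

text \<open>Conservation of mass at a vertex: its subtree consists of the vertex and the disjoint subtrees of
  its children.\<close>

lemma tail_mass_children:
  assumes t: "t \<in> V"
  shows "tail_mass summable_on chld t" and "tail_mass t = local_mass t + (\<Sum>\<^sub>\<infinity>s\<in>chld t. tail_mass s)"
proof -
  let ?S = "SIGMA s:chld t. desc s"
  have inj: "inj_on snd ?S"
    using disjoint_desc_children[of t] by (auto simp: inj_on_def disjoint_family_on_def)
  have im: "snd ` ?S = (\<Union>s\<in>chld t. desc s)" by force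
  have sub: "(\<Union>s\<in>chld t. desc s) \<subseteq> V" using desc_subset by blast
  have "local_mass summable_on (\<Union>s\<in>chld t. desc s)" by (rule has_bochner_integral_lp_sum(2)[OF sub])
  then have S: "(\<lambda>(s, k). local_mass k) summable_on ?S"
    unfolding im[symmetric] summable_on_reindex[OF inj] by (simp add: o_def case_prod_unfold)
  show "tail_mass summable_on chld t"
    using summable_on_Sigma_banach[OF S] by (simp add: tail_mass_eq_mass[abs_def])
  have "(\<Sum>\<^sub>\<infinity>s\<in>chld t. tail_mass s) = infsum (\<lambda>(s, k). local_mass k) ?S"
    using infsum_Sigma'_banach[OF S] by (simp add: tail_mass_eq_mass)
  also have "\<dots> = (\<Sum>\<^sub>\<infinity>k\<in>(\<Union>s\<in>chld t. desc s). local_mass k)"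
    unfolding im[symmetric] infsum_reindex[OF inj] by (simp add: o_def case_prod_unfold)
  finally have eq: "(\<Sum>\<^sub>\<infinity>s\<in>chld t. tail_mass s) = (\<Sum>\<^sub>\<infinity>k\<in>(\<Union>s\<in>chld t. desc s). local_mass k)" .
  have "t \<notin> (\<Union>s\<in>chld t. desc s)" using child_not_ancestor by blast
  then have "(local_mass has_sum (local_mass t + (\<Sum>\<^sub>\<infinity>k\<in>(\<Union>s\<in>chld t. desc s). local_mass k)))
      ({t} \<union> (\<Union>s\<in>chld t. desc s))"
    using has_sum_finite[of "{t}" local_mass] has_bochner_integral_lp_sum(2)[OF sub]
    by (intro has_sum_Un_disjoint) auto
  then show "tail_mass t = local_mass t + (\<Sum>\<^sub>\<infinity>s\<in>chld t. tail_mass s)"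
    unfolding tail_mass_eq_mass[of t] eq desc_unfold[OF t] by (intro infsumI) simp
qed

lemma flux_eq: "flx t x = indicator (B t) x / measure lebesgue (B t) * tail_mass t"
  by (simp add: flux_def tail_mass_def)

lemma flux_outside: "x \<notin> B t \<Longrightarrow> flx t x = 0"
  by (simp add: flux_eq)

lemma B_unique: "x \<in> B s \<Longrightarrow> x \<in> B t \<Longrightarrow> s \<in> V - {a} \<Longrightarrow> t \<in> V - {a} \<Longrightarrow> s = t"
  using disjoint_B unfolding disjoint_family_on_def by blast

text \<open>Bridges are disjoint, so at a point of \<open>B\<^sub>s\<close> only the flux through \<open>B\<^sub>s\<close> is nonzero. It leaves \<open>s\<close>
  and enters the parent of \<open>s\<close>.\<close>

lemma corr_on_bridge:
  assumes s: "s \<in> V - {a}" "x \<in> B s" and t: "t \<in> V"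
  shows "corr t x = (if t = s then flx s x else 0) - (if t = par s then flx s x else 0)"
proof -
  have z: "flx r x = 0" if "r \<in> V - {a}" "r \<noteq> s" for r
    using B_unique[of x r s] that s by (intro flux_outside) blast
  have "(\<Sum>\<^sub>\<infinity>r\<in>chld t. flx r x) = (if t = par s then flx s x else 0)"
  proof (cases "t = par s")
    case True
    then have "((\<lambda>r. flx r x) has_sum flx s x) (chld t)"
      using s z by (intro has_sum_single) (auto simp: children_iff)
    then show ?thesis using True by (simp add: infsumI)
  next
    case False
    then have "flx r x = 0" if "r \<in> chld t" for r
      using z[of r] that by (cases "r = s") (auto simp: children_iff)
    then show ?thesis using False by (simp add: infsum_0)
  qed
  moreover have "(if t = a then 0 else flx t x) = (if t = s then flx s x else 0)"
    using s t z[of t] by auto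
  ultimately show ?thesis by (simp add: correction_def)
qed

lemma corr_off_bridges:
  assumes "\<And>s. s \<in> V - {a} \<Longrightarrow> x \<notin> B s" and "t \<in> V"
  shows "corr t x = 0"
  using assms by (auto simp: correction_def flux_outside children_iff intro!: infsum_0)

lemma corr_has_sum_0: "((\<lambda>t. corr t x) has_sum 0) V"
proof (cases "\<exists>s\<in>V - {a}. x \<in> B s")
  case True
  then obtain s where s: "s \<in> V - {a}" "x \<in> B s" by blast
  have "((\<lambda>t. if t = s then flx s x else 0) has_sum flx s x) V"
    using has_sum_single[of s V "\<lambda>t. if t = s then flx s x else 0"] s by simp
  moreover have "((\<lambda>t. if t = par s then flx s x else 0) has_sum flx s x) V"
    using has_sum_single[of "par s" V "\<lambda>t. if t = par s then flx s x else 0"] s rpath_parent(2)[of s] by simp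
  ultimately have "((\<lambda>t. (if t = s then flx s x else 0) - (if t = par s then flx s x else 0))
      has_sum (flx s x - flx s x)) V"
    by (rule has_sum_diff)
  then show ?thesis
    using corr_on_bridge[OF s] by (subst has_sum_cong) auto
next
  case False
  then have "corr t x = 0" if "t \<in> V" for t using corr_off_bridges[of x t] that by blast
  then show ?thesis by (intro has_sum_0) auto
qed

lemma decomposition_sum: "AE x in M. ((\<lambda>t. tp t x) has_sum f x) V"
  using phi_sum
proof eventually_elim
  case (elim x)
  have "((\<lambda>t. lp t x - corr t x) has_sum (f x * 1 - 0)) V"
    unfolding local_part_def by (intro has_sum_diff has_sum_cmult_right elim corr_has_sum_0)
  then show ?case by (simp add: tree_part_def)
qed

lemma tree_part_outside:
  assumes t: "t \<in> V" and x: "x \<notin> U t"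
  shows "tp t x = 0"
proof -
  have "x \<notin> B s" if "s \<in> chld t" for s
    using B_subset[of s] that x by (auto simp: children_iff)
  then have "(\<Sum>\<^sub>\<infinity>s\<in>chld t. flx s x) = 0" by (auto intro!: infsum_0 simp: flux_outside)
  moreover have "t \<noteq> a \<Longrightarrow> flx t x = 0" using B_subset[of t] t x by (intro flux_outside) auto
  ultimately show ?thesis
    using phi_support[OF t x] by (simp add: tree_part_def local_part_def correction_def)
qed

lemma has_bochner_integral_flux:
  assumes s: "s \<in> V - {a}"
  shows "has_bochner_integral M (flx s) (tail_mass s)"
    and "(\<integral>\<^sup>+x. ennreal \<bar>flx s x\<bar> \<partial>M) = ennreal \<bar>tail_mass s\<bar>"
proof -
  have m: "measure lebesgue (B s) = measure M (B s)"
    using B_subset_W[OF s] W_subset by (intro measure_lebesgue_eq) blast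
  have pos: "0 < measure M (B s)" by (rule measure_B_pos[OF s])
  have [measurable]: "B s \<in> sets M" by (rule B_sets[OF s])
  have e: "flx s x = indicator (B s) x * (tail_mass s / measure M (B s))" for x
    by (simp add: flux_eq m)
  have "has_bochner_integral M (\<lambda>x. indicator (B s) x * (tail_mass s / measure M (B s)))
      (measure M (B s) * (tail_mass s / measure M (B s)))"
    by (intro has_bochner_integral_mult_left has_bochner_integral_real_indicator)
       (auto simp: emeasure_eq_measure)
  then show "has_bochner_integral M (flx s) (tail_mass s)" using pos by (simp add: e[abs_def])
  have "(\<integral>\<^sup>+x. ennreal \<bar>flx s x\<bar> \<partial>M) = (\<integral>\<^sup>+x. ennreal (\<bar>tail_mass s\<bar> / measure M (B s)) * indicator (B s) x \<partial>M)"
    using pos by (intro nn_integral_cong) (simp add: e indicator_def)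
  also have "\<dots> = ennreal (\<bar>tail_mass s\<bar> / measure M (B s)) * ennreal (measure M (B s))"
    by (simp add: nn_integral_cmult_indicator emeasure_eq_measure)
  also have "\<dots> = ennreal \<bar>tail_mass s\<bar>"
    using pos by (simp add: ennreal_mult[symmetric])
  finally show "(\<integral>\<^sup>+x. ennreal \<bar>flx s x\<bar> \<partial>M) = ennreal \<bar>tail_mass s\<bar>" .
qed

text \<open>A vertex may have infinitely many children; the fluxes they send are integrable together because
  the masses of their subtrees are absolutely summable.\<close>

lemma has_bochner_integral_children_flux:
  assumes t: "t \<in> V"
  shows "has_bochner_integral M (\<lambda>x. \<Sum>\<^sub>\<infinity>s\<in>chld t. flx s x) (\<Sum>\<^sub>\<infinity>s\<in>chld t. tail_mass s)"
proof -
  have c: "chld t \<subseteq> V - {a}" by (auto simp: children_iff)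
  have cc: "countable (chld t)" using c countable by (meson Diff_subset countable_subset order_trans)
  have "(\<integral>\<^sup>+s. \<integral>\<^sup>+x. ennreal \<bar>flx s x\<bar> \<partial>M \<partial>count_space (chld t)) = (\<integral>\<^sup>+s. ennreal \<bar>tail_mass s\<bar> \<partial>count_space (chld t))"
    using c by (intro nn_integral_cong has_bochner_integral_flux(2)) auto
  also have "\<dots> < \<infinity>"
    using tail_mass_children(1)[OF t] unfolding summable_on_iff_integrable_count_space
    by (simp add: integrable_iff_bounded)
  finally have fin: "(\<integral>\<^sup>+s. \<integral>\<^sup>+x. ennreal \<bar>flx s x\<bar> \<partial>M \<partial>count_space (chld t)) < \<infinity>" .
  have b: "has_bochner_integral M (flx s) (tail_mass s)" if "s \<in> chld t" for s
    using has_bochner_integral_flux(1) c that by blast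
  have "has_bochner_integral M (\<lambda>x. \<Sum>\<^sub>\<infinity>s\<in>chld t. flx s x) (\<Sum>\<^sub>\<infinity>s\<in>chld t. integral\<^sup>L M (flx s))"
    using b by (intro has_bochner_integral_infsum(1)[OF sigma_finite_measure_axioms cc _ fin])
      (auto dest: borel_measurable_has_bochner_integral)
  also have "(\<Sum>\<^sub>\<infinity>s\<in>chld t. integral\<^sup>L M (flx s)) = (\<Sum>\<^sub>\<infinity>s\<in>chld t. tail_mass s)"
    using b by (intro infsum_cong) (auto dest: has_bochner_integral_integral_eq)
  finally show ?thesis .
qed

text \<open>The integral of a part is the mass of \<open>f\<^sub>t\<close>, minus the mass sent upwards, plus the masses received
  from the children. This vanishes by conservation of mass, except that the root sends
  nothing and keeps the mass of the whole tree.\<close>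

lemma has_bochner_integral_tree_part_M:
  assumes t: "t \<in> V"
  shows "has_bochner_integral M (tp t) (if t = a then integral\<^sup>L M f else 0)"
proof -
  have "has_bochner_integral M (lp t) (local_mass t)"
    using has_bochner_integral_lp_sum(1)[of "{t}"] t by simp
  moreover have "has_bochner_integral M (\<lambda>x. if t = a then 0 else flx t x) (if t = a then 0 else tail_mass t)"
    using has_bochner_integral_flux(1)[of t] t by (cases "t = a") auto
  ultimately have "has_bochner_integral M (tp t)
      (local_mass t - ((if t = a then 0 else tail_mass t) - (\<Sum>\<^sub>\<infinity>s\<in>chld t. tail_mass s)))"
    unfolding tree_part_def[abs_def] correction_def
    by (intro has_bochner_integral_diff has_bochner_integral_children_flux t)
  moreover have "tail_mass a = integral\<^sup>L M f"
  proof -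
    have "AE x in M. (\<Sum>\<^sub>\<infinity>k\<in>V. lp k x) = f x"
      using phi_sum
    proof eventually_elim
      case (elim x)
      then show ?case unfolding local_part_def infsum_cmult_right' by (simp add: infsumI)
    qed
    then show ?thesis
      using has_bochner_integral_lp_sum(1)[of V] unfolding tail_mass_eq desc_root
      by (intro integral_cong_AE) (auto dest: borel_measurable_has_bochner_integral)
  qed
  ultimately show ?thesis using tail_mass_children(2)[OF t] by (cases "t = a") auto
qed

lemma has_bochner_integral_tree_part:
  assumes t: "t \<in> V"
  shows "has_bochner_integral (lebesgue_on (U t)) (tp t) (if t = a then integral\<^sup>L M f else 0)"
proof -
  have "U t \<inter> space M \<in> sets M"
    by (rule Int_space_M[OF U_sets[OF t]])
  moreover have "indicator (U t) x *\<^sub>R tp t x = tp t x" for x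
    using tree_part_outside[OF t, of x] by (cases "x \<in> U t") auto
  ultimately show ?thesis
    unfolding lebesgue_on_subset[OF U_sets[OF t]]
    using has_bochner_integral_tree_part_M[OF t]
    by (subst has_bochner_integral_restrict_space) (simp_all only:)
qed

end

section \<open>Weighted norm estimates\<close>

lemma ennreal_powr_mono: "x \<le> y \<Longrightarrow> 0 < r \<Longrightarrow> ennreal_powr x r \<le> ennreal_powr y r"
  by (cases x; cases y) (auto simp: ennreal_powr_def ennreal_le_iff top_unique intro!: ennreal_leI powr_mono2)

lemma ennreal_powr_mult:
  assumes "0 \<le> m" "x < \<infinity>"
  shows "ennreal_powr (ennreal m * x) r = ennreal (m powr r) * ennreal_powr x r"
  using assms
  by (cases x) (auto simp: ennreal_powr_def ennreal_mult[symmetric] powr_mult ennreal_mult_eq_top_iff)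

lemma ennreal_powr_Lp_norm:
  assumes "0 < p"
  shows "ennreal_powr (Lp_norm p S g) p = (\<integral>\<^sup>+x. ennreal (\<bar>g x\<bar> powr p) \<partial>lebesgue_on S)"
  using assms
  by (cases "\<integral>\<^sup>+x. ennreal (\<bar>g x\<bar> powr p) \<partial>lebesgue_on S") (auto simp: Lp_norm_def ennreal_powr_def powr_powr)

lemma Lp_norm_less_infinity_iff:
  "Lp_norm p S g < \<infinity> \<longleftrightarrow> (\<integral>\<^sup>+x. ennreal (\<bar>g x\<bar> powr p) \<partial>lebesgue_on S) < \<infinity>"
  by (auto simp: Lp_norm_def ennreal_powr_def less_top)

lemma continuous_with_norm_powr:
  assumes "continuous_with_norm p S w w' A m" "g \<in> wLp_space p S w" "0 < p"
  shows "(\<integral>\<^sup>+x. ennreal (\<bar>A g x * w' x\<bar> powr p) \<partial>lebesgue_on S)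
    \<le> ennreal (m powr p) * (\<integral>\<^sup>+x. ennreal (\<bar>g x * w x\<bar> powr p) \<partial>lebesgue_on S)"
proof -
  have m: "0 \<le> m" and le: "wLp_norm p S w' (A g) \<le> ennreal m * wLp_norm p S w g"
    and fin: "wLp_norm p S w g < \<infinity>"
    using assms(1,2) by (auto simp: continuous_with_norm_def wLp_space_def)
  have "ennreal_powr (wLp_norm p S w' (A g)) p \<le> ennreal_powr (ennreal m * wLp_norm p S w g) p"
    by (rule ennreal_powr_mono[OF le assms(3)])
  then show ?thesis
    unfolding ennreal_powr_mult[OF m fin] by (simp add: wLp_norm_def ennreal_powr_Lp_norm[OF assms(3)])
qed

lemma ennreal_linear_combination:
  assumes "0 \<le> c" "0 \<le> A" "0 \<le> D"
  shows "ennreal c * (ennreal A * X + 2 * (ennreal D * X)) = ennreal (c * (A + 2 * D)) * X"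
proof -
  have "ennreal (c * (A + 2 * D)) = ennreal c * (ennreal A + 2 * ennreal D)"
    using assms by (simp add: ennreal_mult ennreal_plus)
  then show ?thesis by (simp add: distrib_left distrib_right mult.assoc)
qed

text \<open>The sum is at most twice the larger summand.\<close>

lemma powr_add_le:
  fixes x y p :: real
  assumes "0 \<le> x" "0 \<le> y" "0 \<le> p"
  shows "(x + y) powr p \<le> 2 powr p * (x powr p + y powr p)"
proof -
  have "(x + y) powr p \<le> (2 * max x y) powr p"
    using assms by (intro powr_mono2) auto
  also have "\<dots> = 2 powr p * max x y powr p" using assms by (simp add: powr_mult)
  also have "max x y powr p \<le> x powr p + y powr p" by (simp add: max_def)
  finally show ?thesis by simp
qed

context tree_covering
begin

abbreviation "wt \<equiv> tree_weight V E a U B"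
abbreviation "T \<equiv> tree_operator V E a U B"

lemma tree_operator_eq: "T g x = (\<Sum>\<^sub>\<infinity>t\<in>V - {a}. indicator (B t) x * avg g t)"
  by (simp add: tree_operator_def avg_def)

lemma tree_operator_on_bridge:
  assumes "s \<in> V - {a}" "x \<in> B s"
  shows "T g x = avg g s"
proof -
  have "((\<lambda>t. indicator (B t) x * avg g t) has_sum (indicator (B s) x * avg g s)) (V - {a})"
    using assms disjoint_B
    by (intro has_sum_single) (auto simp: disjoint_family_on_def indicator_def)
  then show ?thesis using assms by (simp add: tree_operator_eq infsumI)
qed

lemma tree_operator_meas [measurable]: "T g \<in> borel_measurable M"
  unfolding tree_operator_eq[abs_def]
  using B_sets countable by (intro borel_measurable_infsum) auto

lemma tree_weight_on_bridge:
  assumes s: "s \<in> V - {a}" "x \<in> B s"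
  shows "wt x = measure M (B s) / measure M (W s)"
proof -
  have "(THE t. t \<in> V - {a} \<and> x \<in> B t) = s"
    using s disjoint_B by (intro the_equality) (auto simp: disjoint_family_on_def)
  moreover have "B s \<subseteq> \<Omega>" using B_subset_W[OF s(1)] W_subset by blast
  ultimately show ?thesis
    using s by (auto simp: tree_weight_def Let_def measure_lebesgue_eq W_subset)
qed

lemma tree_weight_off_bridges:
  assumes "\<And>s. s \<in> V - {a} \<Longrightarrow> x \<notin> B s"
  shows "wt x = 1"
  using assms by (auto simp: tree_weight_def)

lemma tree_weight_range: "0 \<le> wt x" "wt x \<le> 1"
proof -
  have "0 \<le> wt x \<and> wt x \<le> 1"
  proof (cases "\<exists>s\<in>V - {a}. x \<in> B s")
    case True
    then obtain s where s: "s \<in> V - {a}" "x \<in> B s" by blast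
    show ?thesis
      using measure_B_le_W[OF s(1)] measure_W_pos[OF s(1)] by (simp add: tree_weight_on_bridge[OF s])
  next
    case False
    then have "wt x = 1" by (intro tree_weight_off_bridges) blast
    then show ?thesis by simp
  qed
  then show "0 \<le> wt x" "wt x \<le> 1" by auto
qed

text \<open>As the bridges are disjoint, \<open>T g\<close> is a step function with the average over \<open>W\<^sub>t\<close> as its value on \<open>B\<^sub>t\<close>.\<close>

lemma tree_operator_strong_type:
  assumes g: "integrable M g" and p: "1 < p"
  shows "(\<integral>\<^sup>+x. ennreal (\<bar>T g x\<bar> powr p) \<partial>M)
    \<le> ennreal (2 powr p * N * p / (p - 1)) * (\<integral>\<^sup>+x. ennreal (\<bar>g x\<bar> powr p) \<partial>M)"
proof -
  have cV: "countable (V - {a})" using countable by auto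
  have "(\<integral>\<^sup>+x. ennreal (\<bar>T g x\<bar> powr p) \<partial>M)
      \<le> (\<integral>\<^sup>+x. \<integral>\<^sup>+t. indicator (B t) x * ennreal (avg g t powr p) \<partial>count_space (V - {a}) \<partial>M)"
  proof (rule nn_integral_mono)
    fix x
    show "ennreal (\<bar>T g x\<bar> powr p)
      \<le> (\<integral>\<^sup>+t. indicator (B t) x * ennreal (avg g t powr p) \<partial>count_space (V - {a}))"
    proof (cases "\<exists>s\<in>V - {a}. x \<in> B s")
      case True
      then obtain s where s: "s \<in> V - {a}" "x \<in> B s" by blast
      then show ?thesis
        using nn_integral_ge_point[OF s(1), of "\<lambda>t. indicator (B t) x * ennreal (avg g t powr p)"]
        by (simp add: tree_operator_on_bridge[OF s] avg_nonneg)
    next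
      case False
      then have "T g x = 0" unfolding tree_operator_eq by (intro infsum_0) auto
      then show ?thesis by simp
    qed
  qed
  also have "\<dots> = (\<integral>\<^sup>+t. \<integral>\<^sup>+x. indicator (B t) x * ennreal (avg g t powr p) \<partial>M \<partial>count_space (V - {a}))"
  proof (rule nn_integral_count_space_nn_integral[OF cV])
    fix t assume "t \<in> V - {a}"
    from B_sets[OF this] show "(\<lambda>x. indicator (B t) x * ennreal (avg g t powr p)) \<in> borel_measurable M"
      by measurable
  qed
  also have "\<dots> = (\<integral>\<^sup>+t. emeasure M (B t) * ennreal (avg g t powr p) \<partial>count_space (V - {a}))"
    using B_sets by (intro nn_integral_cong) (simp add: nn_integral_multc)
  also have "\<dots> \<le> ennreal (2 powr p * N * p / (p - 1)) * (\<integral>\<^sup>+x. ennreal (\<bar>g x\<bar> powr p) \<partial>M)"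
    by (rule sum_averages_powr_le[OF g p])
  finally show ?thesis .
qed

text \<open>As \<open>\<Omega>\<close> has finite measure, \<open>1 / w2\<close> belongs to the space with weight \<open>w2\<close>, and it has nonzero norm
  with respect to \<open>w1\<close>. This matters when \<open>f\<close> has infinite norm: in \<open>[0, \<infinity>]\<close> a zero constant would
  make the bound \<open>0 \<cdot> \<infinity> = 0\<close>.\<close>

lemma embedding_norm_pos:
  assumes w: "weight_on \<Omega> w1" "weight_on \<Omega> w2" and p: "0 < p"
    and I: "continuous_with_norm p \<Omega> w2 w1 (\<lambda>h. h) m"
  shows "0 < m"
proof (rule ccontr)
  assume "\<not> 0 < m"
  with I have m: "m = 0" by (simp add: continuous_with_norm_def)
  have [measurable]: "w1 \<in> borel_measurable M" "w2 \<in> borel_measurable M"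
    and pos: "\<And>x. x \<in> \<Omega> \<Longrightarrow> 0 < w1 x" "\<And>x. x \<in> \<Omega> \<Longrightarrow> 0 < w2 x"
    using w by (auto simp: weight_on_def)
  let ?h = "\<lambda>x. 1 / w2 x"
  \<comment> \<open>The value \<open>m = 0\<close> would make \<open>w1 / w2\<close>, which is positive on \<open>\<Omega>\<close>, vanish almost everywhere.\<close>
  have "(\<integral>\<^sup>+x. ennreal (\<bar>?h x * w2 x\<bar> powr p) \<partial>M) = (\<integral>\<^sup>+x. 1 \<partial>M)"
    using pos(2) by (intro nn_integral_cong) (force simp: space_M)
  also have "\<dots> < \<infinity>" by (simp add: emeasure_eq_measure)
  finally have "wLp_norm p \<Omega> w2 ?h < \<infinity>" by (simp only: wLp_norm_def Lp_norm_less_infinity_iff)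
  moreover have "?h \<in> borel_measurable M" by measurable
  ultimately have "?h \<in> wLp_space p \<Omega> w2" by (simp only: wLp_space_def mem_Collect_eq)
  from continuous_with_norm_powr[OF I this p]
  have "(\<integral>\<^sup>+x. ennreal (\<bar>?h x * w1 x\<bar> powr p) \<partial>M) = 0" using p by (simp add: m)
  then have "AE x in M. ennreal (\<bar>?h x * w1 x\<bar> powr p) = 0"
    by (subst (asm) nn_integral_0_iff_AE) auto
  then have "AE x in lebesgue. x \<in> \<Omega> \<longrightarrow> ennreal (\<bar>?h x * w1 x\<bar> powr p) = 0"
    using sets_Omega by (subst (asm) AE_restrict_space_iff) auto
  then have "AE x in lebesgue. x \<notin> \<Omega>"
    by eventually_elim (use pos in \<open>fastforce simp: ennreal_eq_0_iff\<close>)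
  then show False using Omega_not_null by blast
qed

end

context tree_decomposition
begin

text \<open>The set off which the correction at \<open>t\<close> vanishes: the bridge to the parent and the bridges to the
  children. The root has no bridge to a parent.\<close>

definition bridge_zone :: "'v \<Rightarrow> 'b set" where
  "bridge_zone t = (\<Union>s\<in>{s \<in> V - {a}. t = s \<or> t = par s}. B s)"

lemma bridge_zone_sets: "bridge_zone t \<in> sets M"
  unfolding bridge_zone_def using countable B_sets by (intro sets.countable_UN') auto

lemma bridge_zone_overlap: "(\<integral>\<^sup>+t. indicator (bridge_zone t) x \<partial>count_space V) \<le> (2 :: ennreal)"
proof (cases "\<exists>s\<in>V - {a}. x \<in> B s")
  case True
  then obtain s where s: "s \<in> V - {a}" "x \<in> B s" by blast
  have "x \<notin> bridge_zone t" if "t \<notin> {s, par s}" for t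
  proof
    assume "x \<in> bridge_zone t"
    then obtain r where r: "r \<in> V - {a}" "t = r \<or> t = par r" "x \<in> B r" unfolding bridge_zone_def by blast
    then have "r = s" using B_unique s by blast
    with r that show False by blast
  qed
  then have "(\<integral>\<^sup>+t. indicator (bridge_zone t) x \<partial>count_space V) = (\<Sum>t\<in>{s, par s}. indicator (bridge_zone t) x :: ennreal)"
    using s rpath_parent(2)[of s] by (intro nn_integral_count_space') auto
  also have "\<dots> \<le> (\<Sum>t\<in>{s, par s}. 1)" by (intro sum_mono) (simp add: indicator_def)
  also have "\<dots> = 2" using parent_neq[of s] s by simp
  finally show ?thesis .
next
  case False
  then have "x \<notin> bridge_zone t" for t by (auto simp: bridge_zone_def)
  then show ?thesis by simp
qed

text \<open>On \<open>B\<^sub>s\<close> the flux has height \<open>\<bar>tail_mass s\<bar> / |B\<^sub>s|\<close>, and the weight replaces the denominator by \<open>|W\<^sub>s|\<close>.\<close>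

lemma weighted_corr_le:
  assumes t: "t \<in> V"
  shows "\<bar>corr t x\<bar> * wt x \<le> indicator (bridge_zone t) x * \<bar>T f x\<bar>"
proof (cases "\<exists>s\<in>V - {a}. x \<in> B s")
  case True
  then obtain s where s: "s \<in> V - {a}" "x \<in> B s" by blast
  have m: "measure lebesgue (B s) = measure M (B s)"
    using B_subset_W[OF s(1)] W_subset by (intro measure_lebesgue_eq) blast
  have pos: "0 < measure M (B s)" "0 < measure M (W s)"
    using measure_B_pos measure_W_pos s by auto
  have "\<bar>flx s x\<bar> * wt x = \<bar>tail_mass s\<bar> / measure M (W s)"
    using pos s(2) by (simp add: flux_eq m tree_weight_on_bridge[OF s])
  also have "\<dots> \<le> avg f s"
    using tail_mass_abs_le[OF s(1)] pos by (simp add: divide_le_eq)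
  finally have le: "\<bar>flx s x\<bar> * wt x \<le> T f x" by (simp add: tree_operator_on_bridge[OF s])
  show ?thesis
  proof (cases "t = s \<or> t = par s")
    case True
    then have "x \<in> bridge_zone t" using s by (auto simp: bridge_zone_def)
    moreover have "\<bar>corr t x\<bar> = \<bar>flx s x\<bar>"
      using True parent_neq[of s] s by (auto simp: corr_on_bridge[OF s t])
    ultimately show ?thesis using le by simp
  next
    case False
    then have "corr t x = 0" by (simp add: corr_on_bridge[OF s t])
    then show ?thesis by simp
  qed
next
  case False
  then have "corr t x = 0" using corr_off_bridges[of x t] t by blast
  then show ?thesis by simp
qed

text \<open>A single power of \<open>\<phi>\<^sub>t\<close> survives from \<open>\<phi>\<^sub>t\<^sup>p \<le> \<phi>\<^sub>t\<close>, so that the first terms add up over \<open>t\<close> to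
  \<open>\<bar>f v\<bar>\<^sup>p\<close>.\<close>

lemma weighted_tree_part_powr_le:
  assumes t: "t \<in> V" and p: "1 < p"
  shows "\<bar>tp t x * (wt x * v x)\<bar> powr p
    \<le> 2 powr p * (\<phi> t x * \<bar>f x * v x\<bar> powr p + indicator (bridge_zone t) x * \<bar>T f x * v x\<bar> powr p)"
proof -
  let ?A = "\<phi> t x * \<bar>f x * v x\<bar>" and ?D = "indicator (bridge_zone t) x * \<bar>T f x * v x\<bar>"
  have "\<bar>tp t x\<bar> \<le> \<bar>lp t x\<bar> + \<bar>corr t x\<bar>" by (simp add: tree_part_def)
  then have "\<bar>tp t x\<bar> * wt x \<le> (\<bar>lp t x\<bar> + \<bar>corr t x\<bar>) * wt x"
    using tree_weight_range(1) by (rule mult_right_mono)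
  also have "\<dots> \<le> \<bar>lp t x\<bar> + indicator (bridge_zone t) x * \<bar>T f x\<bar>"
    using weighted_corr_le[OF t, of x] mult_left_le[OF tree_weight_range(2), of "\<bar>lp t x\<bar>" x]
    by (simp add: distrib_right)
  finally have "\<bar>tp t x\<bar> * wt x * \<bar>v x\<bar> \<le> (\<bar>lp t x\<bar> + indicator (bridge_zone t) x * \<bar>T f x\<bar>) * \<bar>v x\<bar>"
    by (rule mult_right_mono) simp
  then have "\<bar>tp t x * (wt x * v x)\<bar> \<le> ?A + ?D"
    using phi_range(1)[OF t] tree_weight_range(1)
    by (simp add: local_part_def abs_mult algebra_simps)
  then have "\<bar>tp t x * (wt x * v x)\<bar> powr p \<le> (?A + ?D) powr p"
    using p by (intro powr_mono2) auto
  also have "\<dots> \<le> 2 powr p * (?A powr p + ?D powr p)"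
    using p phi_range(1)[OF t] by (intro powr_add_le) auto
  also have "?A powr p \<le> \<phi> t x * \<bar>f x * v x\<bar> powr p"
  proof -
    have "\<phi> t x powr p \<le> \<phi> t x powr 1"
      using p phi_range[OF t] by (intro powr_mono') auto
    then have "\<phi> t x powr p \<le> \<phi> t x" using phi_range(1)[OF t] by simp
    then show ?thesis using phi_range(1)[OF t] by (simp add: powr_mult mult_right_mono)
  qed
  also have "?D powr p = indicator (bridge_zone t) x * \<bar>T f x * v x\<bar> powr p"
    using p by (simp add: indicator_def)
  finally show ?thesis by simp
qed

text \<open>The estimate before any bound on \<open>T\<close> enters. The factor 2 counts the two ends of a bridge.\<close>

lemma weighted_parts_le:
  assumes v [measurable]: "v \<in> borel_measurable M" and p: "1 < p"
  shows "(\<Sum>\<^sub>\<infinity>t\<in>V. ennreal_powr (wLp_norm p (U t) (\<lambda>x. wt x * v x) (tp t)) p)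
    \<le> ennreal (2 powr p) * ((\<integral>\<^sup>+x. ennreal (\<bar>f x * v x\<bar> powr p) \<partial>M)
        + 2 * (\<integral>\<^sup>+x. ennreal (\<bar>T f x * v x\<bar> powr p) \<partial>M))"
proof -
  define X where "X x = ennreal (\<bar>f x * v x\<bar> powr p)" for x
  define Y where "Y x = ennreal (\<bar>T f x * v x\<bar> powr p)" for x
  have [measurable]: "X \<in> borel_measurable M" "Y \<in> borel_measurable M"
    unfolding X_def[abs_def] Y_def[abs_def] by measurable
  define G where "G t x = ennreal (\<phi> t x) * X x + indicator (bridge_zone t) x * Y x" for t x
  have G_meas: "G t \<in> borel_measurable M" if "t \<in> V" for t
    using phi_meas[OF that] bridge_zone_sets[of t] unfolding G_def[abs_def] by measurable
  have part: "ennreal_powr (wLp_norm p (U t) (\<lambda>x. wt x * v x) (tp t)) p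
      \<le> ennreal (2 powr p) * (\<integral>\<^sup>+x. G t x \<partial>M)" if t: "t \<in> V" for t
  proof -
    have "U t \<inter> space M \<in> sets M"
      by (rule Int_space_M[OF U_sets[OF t]])
    note restr = nn_integral_restrict_space[OF this]
    have "ennreal_powr (wLp_norm p (U t) (\<lambda>x. wt x * v x) (tp t)) p
        = (\<integral>\<^sup>+x. ennreal (\<bar>tp t x * (wt x * v x)\<bar> powr p) \<partial>lebesgue_on (U t))"
      using p by (simp add: wLp_norm_def ennreal_powr_Lp_norm)
    also have "\<dots> = (\<integral>\<^sup>+x. ennreal (\<bar>tp t x * (wt x * v x)\<bar> powr p) * indicator (U t) x \<partial>M)"
      unfolding lebesgue_on_subset[OF U_sets[OF t]] by (rule restr)
    also have "\<dots> \<le> (\<integral>\<^sup>+x. ennreal (2 powr p) * G t x \<partial>M)"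
    proof (rule nn_integral_mono)
      fix x
      have "ennreal (\<bar>tp t x * (wt x * v x)\<bar> powr p) * indicator (U t) x
          \<le> ennreal (\<bar>tp t x * (wt x * v x)\<bar> powr p)"
        by (simp add: indicator_def)
      also have "\<dots> \<le> ennreal (2 powr p
          * (\<phi> t x * \<bar>f x * v x\<bar> powr p + indicator (bridge_zone t) x * \<bar>T f x * v x\<bar> powr p))"
        by (intro ennreal_leI weighted_tree_part_powr_le t p)
      also have "\<dots> = ennreal (2 powr p) * G t x"
        using phi_range(1)[OF t, of x]
        by (simp add: G_def X_def Y_def ennreal_mult ennreal_plus ennreal_indicator)
      finally show "ennreal (\<bar>tp t x * (wt x * v x)\<bar> powr p) * indicator (U t) x
          \<le> ennreal (2 powr p) * G t x" .
    qed
    also have "\<dots> = ennreal (2 powr p) * (\<integral>\<^sup>+x. G t x \<partial>M)"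
      by (rule nn_integral_cmult[OF G_meas[OF t]])
    finally show ?thesis .
  qed
  have "(\<Sum>\<^sub>\<infinity>t\<in>V. ennreal_powr (wLp_norm p (U t) (\<lambda>x. wt x * v x) (tp t)) p)
      \<le> (\<integral>\<^sup>+t. ennreal (2 powr p) * (\<integral>\<^sup>+x. G t x \<partial>M) \<partial>count_space V)"
    unfolding infsum_ennreal_eq_nn_integral_count_space[OF countable]
    by (intro nn_integral_mono part) simp
  also have "\<dots> = ennreal (2 powr p) * (\<integral>\<^sup>+t. \<integral>\<^sup>+x. G t x \<partial>M \<partial>count_space V)"
    by (rule nn_integral_cmult) simp
  also have "(\<integral>\<^sup>+t. \<integral>\<^sup>+x. G t x \<partial>M \<partial>count_space V) = (\<integral>\<^sup>+x. \<integral>\<^sup>+t. G t x \<partial>count_space V \<partial>M)"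
    by (rule nn_integral_count_space_nn_integral[symmetric, OF countable G_meas])
  also have "\<dots> \<le> (\<integral>\<^sup>+x. X x + 2 * Y x \<partial>M)"
  proof (rule nn_integral_mono_AE)
    show "AE x in M. (\<integral>\<^sup>+t. G t x \<partial>count_space V) \<le> X x + 2 * Y x"
      using phi_nn_sum
    proof eventually_elim
      case (elim x)
      have "(\<integral>\<^sup>+t. G t x \<partial>count_space V)
          = (\<integral>\<^sup>+t. ennreal (\<phi> t x) \<partial>count_space V) * X x + (\<integral>\<^sup>+t. indicator (bridge_zone t) x \<partial>count_space V) * Y x"
        by (simp add: G_def nn_integral_add nn_integral_multc)
      also have "\<dots> \<le> 1 * X x + 2 * Y x"
        using elim by (intro add_mono mult_right_mono bridge_zone_overlap) auto
      finally show ?case by simp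
    qed
  qed
  also have "\<dots> = (\<integral>\<^sup>+x. X x \<partial>M) + 2 * (\<integral>\<^sup>+x. Y x \<partial>M)"
    by (simp add: nn_integral_add nn_integral_cmult)
  finally show ?thesis by (simp add: X_def Y_def mult_left_mono)
qed

lemma unweighted_parts_le:
  assumes p: "1 < p"
  shows "(\<Sum>\<^sub>\<infinity>t\<in>V. ennreal_powr (wLp_norm p (U t) wt (tp t)) p)
    \<le> ennreal (2 powr p * N * (1 + 2 powr (p + 1) * p / (p - 1))) * ennreal_powr (Lp_norm p \<Omega> f) p"
proof -
  let ?K = "2 powr p * N * p / (p - 1)" and ?X = "\<integral>\<^sup>+x. ennreal (\<bar>f x\<bar> powr p) \<partial>M"
  have K: "0 \<le> ?K" using p N_ge_1 by simp
  have "(\<Sum>\<^sub>\<infinity>t\<in>V. ennreal_powr (wLp_norm p (U t) wt (tp t)) p)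
      \<le> ennreal (2 powr p) * (?X + 2 * (\<integral>\<^sup>+x. ennreal (\<bar>T f x\<bar> powr p) \<partial>M))"
    using weighted_parts_le[of "\<lambda>_. 1" p] p by simp
  also have "\<dots> \<le> ennreal (2 powr p) * (?X + 2 * (ennreal ?K * ?X))"
    by (intro mult_left_mono add_left_mono tree_operator_strong_type[OF f p]) auto
  also have "\<dots> = ennreal (2 powr p * (1 + 2 * ?K)) * ?X"
    using ennreal_linear_combination[of "2 powr p" 1 ?K ?X] K by simp
  also have "\<dots> \<le> ennreal (2 powr p * N * (1 + 2 powr (p + 1) * p / (p - 1))) * ?X"
  proof (intro mult_right_mono ennreal_leI)
    have "2 powr p * (1 + 2 * ?K) \<le> 2 powr p * (N + 2 * ?K)"
      using N_ge_1 by (intro mult_left_mono) auto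
    also have "\<dots> = 2 powr p * N * (1 + 2 powr (p + 1) * p / (p - 1))"
      by (simp add: powr_add algebra_simps)
    finally show "2 powr p * (1 + 2 * ?K) \<le> 2 powr p * N * (1 + 2 powr (p + 1) * p / (p - 1))" .
  qed simp
  finally show ?thesis using p by (simp add: ennreal_powr_Lp_norm)
qed

lemma two_weight_parts_le:
  assumes p: "1 < p" and w: "weight_on \<Omega> w1" "weight_on \<Omega> w2"
    and I: "continuous_with_norm p \<Omega> w2 w1 (\<lambda>h. h) mI"
    and T: "continuous_with_norm p \<Omega> w2 w1 T mT"
  shows "(\<Sum>\<^sub>\<infinity>t\<in>V. ennreal_powr (wLp_norm p (U t) (\<lambda>x. wt x * w1 x) (tp t)) p)
    \<le> ennreal (2 powr p * (N * mI powr p + 2 * mT powr p)) * ennreal_powr (wLp_norm p \<Omega> w2 f) p"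
proof -
  let ?X = "\<integral>\<^sup>+x. ennreal (\<bar>f x * w2 x\<bar> powr p) \<partial>M"
  have X: "ennreal_powr (wLp_norm p \<Omega> w2 f) p = ?X"
    using p by (simp add: wLp_norm_def ennreal_powr_Lp_norm)
  show ?thesis
  proof (cases "?X = \<infinity>")
    case True
    have "0 < N * mI powr p"
      using embedding_norm_pos[OF w _ I] p N_ge_1 by (intro mult_pos_pos) auto
    then have "0 < 2 powr p * (N * mI powr p + 2 * mT powr p)"
      by (simp add: add_pos_nonneg)
    then have "ennreal (2 powr p * (N * mI powr p + 2 * mT powr p)) * \<infinity> = \<infinity>"
      by (simp only: infinity_ennreal_def ennreal_mult_eq_top_iff ennreal_eq_0_iff not_le) simp
    then show ?thesis unfolding X True by simp
  next
    case False
    then have fin: "f \<in> wLp_space p \<Omega> w2"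
      unfolding wLp_space_def wLp_norm_def mem_Collect_eq Lp_norm_less_infinity_iff
      by (simp add: less_top)
    have [measurable]: "w1 \<in> borel_measurable M" using w by (simp add: weight_on_def)
    have p0: "0 < p" using p by simp
    have "(\<Sum>\<^sub>\<infinity>t\<in>V. ennreal_powr (wLp_norm p (U t) (\<lambda>x. wt x * w1 x) (tp t)) p)
        \<le> ennreal (2 powr p) * ((\<integral>\<^sup>+x. ennreal (\<bar>f x * w1 x\<bar> powr p) \<partial>M)
          + 2 * (\<integral>\<^sup>+x. ennreal (\<bar>T f x * w1 x\<bar> powr p) \<partial>M))"
      by (rule weighted_parts_le) (use p in auto)
    also have "\<dots> \<le> ennreal (2 powr p) * (ennreal (mI powr p) * ?X + 2 * (ennreal (mT powr p) * ?X))"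
      by (intro mult_left_mono add_mono continuous_with_norm_powr[OF I fin p0]
          continuous_with_norm_powr[OF T fin p0]) auto
    also have "\<dots> = ennreal (2 powr p * (mI powr p + 2 * mT powr p)) * ?X"
      by (rule ennreal_linear_combination) auto
    also have "\<dots> \<le> ennreal (2 powr p * (N * mI powr p + 2 * mT powr p)) * ?X"
      using mult_right_mono[OF N_ge_1, of "mI powr p"]
      by (intro mult_right_mono ennreal_leI mult_left_mono) auto
    finally show ?thesis by (simp only: X)
  qed
qed

end

theorem theorem3p1:
  fixes \<Omega> :: "(real ^ 'n) set"
    and V :: "'v set" and E :: "'v \<Rightarrow> 'v \<Rightarrow> bool" and a :: 'v
    and U B :: "'v \<Rightarrow> (real ^ 'n) set"
    and \<phi> :: "'v \<Rightarrow> real ^ 'n \<Rightarrow> real"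
    and f :: "real ^ 'n \<Rightarrow> real"
    and N p :: real
  assumes "is_domain \<Omega>" and "bounded \<Omega>"
    and "rooted_tree V E a" and "countable V"
    and "\<And>t. t \<in> V \<Longrightarrow> is_domain (U t) \<and> U t \<subseteq> \<Omega>"
    and "overlap_condition V U \<Omega> N"
    and "bridge_condition V E a U B"
    and "partition_of_unity V U \<Omega> \<phi>"
    and "integrable (lebesgue_on \<Omega>) f"
    and "1 < p"
  defines "\<omega> \<equiv> tree_weight V E a U B"
    and "T \<equiv> tree_operator V E a U B"
    and "g \<equiv> tree_part V E a U B \<phi> f"
  shows "(AE x in lebesgue_on \<Omega>. ((\<lambda>t. g t x) has_sum f x) V) \<and>
    (\<forall>t\<in>V. \<forall>x. x \<notin> U t \<longrightarrow> g t x = 0) \<and>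
    (\<forall>t\<in>V - {a}. has_bochner_integral (lebesgue_on (U t)) (g t) 0) \<and>
    has_bochner_integral (lebesgue_on (U a)) (g a) (\<integral>x. f x \<partial>lebesgue_on \<Omega>) \<and>
    (\<Sum>\<^sub>\<infinity>t\<in>V. ennreal_powr (wLp_norm p (U t) \<omega> (g t)) p)
      \<le> ennreal (2 powr p * N * (1 + 2 powr (p + 1) * p / (p - 1))) *
         ennreal_powr (Lp_norm p \<Omega> f) p \<and>
    (\<forall>w\<^sub>1 w\<^sub>2 M\<^sub>I M\<^sub>T.
       weight_on \<Omega> w\<^sub>1 \<and> weight_on \<Omega> w\<^sub>2 \<and>
       wLp_space p \<Omega> w\<^sub>2 \<subseteq> {h. integrable (lebesgue_on \<Omega>) h} \<and>
       continuous_with_norm p \<Omega> w\<^sub>2 w\<^sub>1 (\<lambda>h. h) M\<^sub>I \<and>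
       continuous_with_norm p \<Omega> w\<^sub>2 w\<^sub>1 T M\<^sub>T \<longrightarrow>
       (\<Sum>\<^sub>\<infinity>t\<in>V. ennreal_powr (wLp_norm p (U t) (\<lambda>x. \<omega> x * w\<^sub>1 x) (g t)) p)
         \<le> ennreal (2 powr p * (N * M\<^sub>I powr p + 2 * M\<^sub>T powr p)) *
            ennreal_powr (wLp_norm p \<Omega> w\<^sub>2 f) p)"
proof -
  interpret tree_decomposition V E a \<Omega> U B N \<phi> f
    by unfold_locales (fact assms)+
  show ?thesis
    unfolding \<omega>_def T_def g_def
  proof (intro conjI allI impI ballI)
    show "has_bochner_integral (lebesgue_on (U t)) (tree_part V E a U B \<phi> f t) 0" if "t \<in> V - {a}" for t
      using has_bochner_integral_tree_part[of t] that by simp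
    show "has_bochner_integral (lebesgue_on (U a)) (tree_part V E a U B \<phi> f a) (\<integral>x. f x \<partial>lebesgue_on \<Omega>)"
      using has_bochner_integral_tree_part[OF root_in] by simp
    show "AE x in lebesgue_on \<Omega>. ((\<lambda>t. tree_part V E a U B \<phi> f t x) has_sum f x) V"
      by (rule decomposition_sum)
    show "tree_part V E a U B \<phi> f t x = 0" if "t \<in> V" "x \<notin> U t" for t x
      using that by (rule tree_part_outside)
    show "(\<Sum>\<^sub>\<infinity>t\<in>V. ennreal_powr (wLp_norm p (U t) (tree_weight V E a U B) (tree_part V E a U B \<phi> f t)) p)
      \<le> ennreal (2 powr p * N * (1 + 2 powr (p + 1) * p / (p - 1))) *
         ennreal_powr (Lp_norm p \<Omega> f) p"
      by (rule unweighted_parts_le[OF \<open>1 < p\<close>])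
  next
    fix w\<^sub>1 w\<^sub>2 M\<^sub>I M\<^sub>T
    assume "weight_on \<Omega> w\<^sub>1 \<and> weight_on \<Omega> w\<^sub>2 \<and>
       wLp_space p \<Omega> w\<^sub>2 \<subseteq> {h. integrable (lebesgue_on \<Omega>) h} \<and>
       continuous_with_norm p \<Omega> w\<^sub>2 w\<^sub>1 (\<lambda>h. h) M\<^sub>I \<and>
       continuous_with_norm p \<Omega> w\<^sub>2 w\<^sub>1 (tree_operator V E a U B) M\<^sub>T"
    then show "(\<Sum>\<^sub>\<infinity>t\<in>V. ennreal_powr
         (wLp_norm p (U t) (\<lambda>x. tree_weight V E a U B x * w\<^sub>1 x) (tree_part V E a U B \<phi> f t)) p)
         \<le> ennreal (2 powr p * (N * M\<^sub>I powr p + 2 * M\<^sub>T powr p)) *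
            ennreal_powr (wLp_norm p \<Omega> w\<^sub>2 f) p"
      by (elim conjE) (rule two_weight_parts_le[OF \<open>1 < p\<close>])
  qed
qed

end
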